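(* For any copula $C$ with $\|C\|=1$, there exists a sequence $\{S_n\}$ of shuffles of Min such that $\|C-S_n\|\to 0$ as $n\to\infty$.
   Context: A (bivariate) copula is a function $C\colon[0,1]^2\to[0,1]$ with $C(u,0)=0=C(0,v)$, $C(u,1)=u$, $C(1,v)=v$ and $C(u,v)-C(u,y)-C(x,v)+C(x,y)\ge 0$ whenever $x\le u$, $y\le v$. It induces a Borel measure $\mu_C$ on $[0,1]^2$ with $\mu_C([x,u]\times[y,v])=C(u,v)-C(u,y)-C(x,v)+C(x,y)$. For $A$ in the linear span of the copulas, the Sobolev norm is $\|A\|^2=\int_0^1\int_0^1\big((\partial_1A(x,y))^2+(\partial_2A(x,y))^2\big)\,dx\,dy$. A shuffle of Min is a copula obtained from $M(x,y)=\min(x,y)$ by permuting (and possibly flipping) the support of $M$ on finitely many vertical strips given by a partition $0=a_0<a_1<\dots<a_n=1$; that is, a copula $S$ such that $\mu_S$ is concentrated on the graph of a bijection $f\colon[0,1]\to[0,1]$ that is measure-preserving (for Lebesgue measure) and is affine with slope $+1$ or $-1$ on each open subinterval $(a_{i-1},a_i)$ of some finite partition of $[0,1]$. *)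

theory Defs
  imports "HOL-Analysis.Analysis"
begin

(* Functions on the unit square are total functions on the plane; no definition below
   depends on their values outside [0,1]^2. *)

definition copula :: "(real \<Rightarrow> real \<Rightarrow> real) \<Rightarrow> bool" where
  "copula C \<longleftrightarrow>
     (\<forall>u\<in>{0..1}. \<forall>v\<in>{0..1}. C u v \<in> {0..1}) \<and>
     (\<forall>u\<in>{0..1}. C u 0 = 0 \<and> C u 1 = u) \<and>
     (\<forall>v\<in>{0..1}. C 0 v = 0 \<and> C 1 v = v) \<and>
     (\<forall>x\<in>{0..1}. \<forall>u\<in>{0..1}. \<forall>y\<in>{0..1}. \<forall>v\<in>{0..1}.
        x \<le> u \<longrightarrow> y \<le> v \<longrightarrow> C u v - C u y - C x v + C x y \<ge> 0)"

(* The induced measure is given as a relation; it is unique because closed rectangles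
   form an intersection-stable generator of the Borel sets of the unit square. *)
definition copula_measure :: "(real \<Rightarrow> real \<Rightarrow> real) \<Rightarrow> (real \<times> real) measure \<Rightarrow> bool" where
  "copula_measure C \<mu> \<longleftrightarrow>
     space \<mu> = {0..1} \<times> {0..1} \<and>
     sets \<mu> = sets (restrict_space borel ({0..1} \<times> {0..1})) \<and>
     (\<forall>x\<in>{0..1}. \<forall>u\<in>{0..1}. \<forall>y\<in>{0..1}. \<forall>v\<in>{0..1}.
        x \<le> u \<longrightarrow> y \<le> v \<longrightarrow>
        emeasure \<mu> ({x..u} \<times> {y..v}) = ennreal (C u v - C u y - C x v + C x y))"

(* Interval integrals range over the open interval (0,1), so only derivatives at interior
   points enter.  Where a partial derivative does not exist, deriv has an unspecified
   constant value; for the linear span of the copulas this happens only on a null set. *)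
definition sobolev_norm :: "(real \<Rightarrow> real \<Rightarrow> real) \<Rightarrow> real" where
  "sobolev_norm A =
     sqrt (LBINT y=0..1. (LBINT x=0..1. (deriv (\<lambda>s. A s y) x)\<^sup>2 + (deriv (\<lambda>t. A x t) y)\<^sup>2))"

definition lebesgue_preserving :: "(real \<Rightarrow> real) \<Rightarrow> bool" where
  "lebesgue_preserving f \<longleftrightarrow>
     f \<in> restrict_space lborel {0..1} \<rightarrow>\<^sub>M restrict_space lborel {0..1} \<and>
     distr (restrict_space lborel {0..1}) (restrict_space lborel {0..1}) f
       = restrict_space lborel {0..1}"

definition piecewise_unit_affine :: "(real \<Rightarrow> real) \<Rightarrow> bool" where
  "piecewise_unit_affine f \<longleftrightarrow>
     (\<exists>(n::nat) (a :: nat \<Rightarrow> real).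
        a 0 = 0 \<and> a n = 1 \<and> (\<forall>i<n. a i < a (Suc i)) \<and>
        (\<forall>i<n. \<exists>s\<in>{1, -1}. \<exists>b. \<forall>x\<in>{a i<..<a (Suc i)}. f x = s * x + b))"

definition shuffle_of_min :: "(real \<Rightarrow> real \<Rightarrow> real) \<Rightarrow> bool" where
  "shuffle_of_min S \<longleftrightarrow>
     copula S \<and>
     (\<exists>\<mu> f. copula_measure S \<mu> \<and>
        bij_betw f {0..1} {0..1} \<and> lebesgue_preserving f \<and> piecewise_unit_affine f \<and>
        (AE p in \<mu>. p \<in> {(x, f x) | x. x \<in> {0..1}}))"

end

theory Submission
  imports Defs
begin

text \<open>
For a copula \<open>C\<close> every section \<open>\<lambda>s. C s y\<close> is increasing with difference quotients at most 1,
so its derivative lies between 0 and 1 and integrates to \<open>y\<close>.  As \<open>d\<^sup>2 \<le> d\<close> on the unit interval,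
each of the two directional energies (the integrals of the squares of the two partial derivatives)
is at most \<open>1/2\<close>.  Hence norm 1 forces equality, and on almost every line the squared derivative of
\<open>C\<close> has the same integral as the derivative itself (\<open>extreme_copula_lines\<close>).

This turns weak convergence into strong convergence.  For \<open>c\<close>, \<open>d\<close> in the unit interval,
\<open>(c - d)\<^sup>2 \<le> c + d - 2 * c * d\<close>.  If copulas \<open>S n\<close> converge pointwise to \<open>C\<close>, then on a line the
integrals of the derivatives over intervals converge, hence so do the integrals against any
integrable weight (\<open>bounded_weak_limit_from_generator\<close>).  With the derivative of \<open>C\<close> itself as the weight,
the right-hand side integrates to something that tends to 0 on every extreme line
(\<open>unit_slope_deriv_strong_limit\<close>), and dominated convergence over the lines gives
\<open>sobolev_limit_of_pointwise_limit\<close>: for a copula of norm 1, pointwise convergence of copulas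
implies convergence in the Sobolev norm.

The analytic basis is that an increasing function with difference quotients at most 1 is
differentiable almost everywhere and is the integral of its derivative.  Its Stieltjes measure is
dominated by Lebesgue measure, so the Radon-Nikodym theorem provides a density, and
Lebesgue differentiation identifies the density with the derivative.

It remains to approximate an arbitrary copula pointwise by shuffles.  Divide the square into an
\<open>N\<close> by \<open>N\<close> grid.  Cut the \<open>i\<close>-th vertical strip into intervals whose lengths are the masses of its
cells, cut each horizontal strip likewise, and translate the interval of cell \<open>(i, j)\<close> in the
first axis onto its interval in the second.  The result is a measure-preserving bijection, its copula
gives every cell the same mass as \<open>C\<close>, so the two copulas agree at the grid points
(\<open>grid_shuffle_at_grid\<close>) and differ by at most \<open>2 / N\<close> everywhere.
\<close>

section \<open>Borel measurability of derivatives\<close>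

text \<open>
A countable Cauchy criterion: by continuity away from 0 it is enough to compare rational arguments,
so when \<open>q\<close> depends measurably on a parameter, the set of parameters for which the limit exists is
measurable.
\<close>
lemma has_limit_at_zero_iff_rational_Cauchy:
  fixes q :: "real \<Rightarrow> real"
  assumes cont: "continuous_on (- {0}) q"
  shows "(\<exists>L. (q \<longlongrightarrow> L) (at 0)) \<longleftrightarrow>
    (\<forall>k::nat. \<exists>N::nat. \<forall>s t :: rat. s \<noteq> 0 \<and> t \<noteq> 0 \<and> \<bar>of_rat s\<bar> < 1 / real (Suc N) \<and> \<bar>of_rat t\<bar> < 1 / real (Suc N)
        \<longrightarrow> \<bar>q (of_rat s) - q (of_rat t)\<bar> \<le> 1 / real (Suc k))" (is "_ \<longleftrightarrow> ?C")
proof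
  assume "\<exists>L. (q \<longlongrightarrow> L) (at 0)"
  then obtain L where L: "(q \<longlongrightarrow> L) (at 0)" by blast
  show ?C
  proof
    fix k :: nat
    have "1 / real (Suc k) / 2 > 0" by simp
    from LIM_D[OF L this] obtain d where d: "d > 0"
      "\<And>h. h \<noteq> 0 \<Longrightarrow> \<bar>h\<bar> < d \<Longrightarrow> \<bar>q h - L\<bar> < 1 / real (Suc k) / 2" by auto
    obtain N where N: "1 / real (Suc N) < d"
      by (rule nat_approx_posE[OF d(1)])
    have "\<bar>q (of_rat s) - q (of_rat t)\<bar> \<le> 1 / real (Suc k)"
      if "s \<noteq> 0" "t \<noteq> 0" "\<bar>of_rat s\<bar> < 1 / real (Suc N)" "\<bar>of_rat t\<bar> < 1 / real (Suc N)" for s t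
    proof -
      have tri: "\<bar>a - b\<bar> \<le> e" if "\<bar>a - L\<bar> < e / 2" "\<bar>b - L\<bar> < e / 2" for a b e
        using that by linarith
      show ?thesis
        by (rule tri; rule d(2)) (use that less_trans[OF _ N] in simp_all)
    qed
    then show "\<exists>N::nat. \<forall>s t :: rat. s \<noteq> 0 \<and> t \<noteq> 0 \<and> \<bar>of_rat s\<bar> < 1 / real (Suc N) \<and> \<bar>of_rat t\<bar> < 1 / real (Suc N)
        \<longrightarrow> \<bar>q (of_rat s) - q (of_rat t)\<bar> \<le> 1 / real (Suc k)" by blast
  qed
next
  assume C: ?C
  define X where "X n = q (1 / real (Suc n))" for n
  have X_eq: "X n = q (of_rat (1 / of_nat (Suc n)))" for n
    by (simp add: X_def of_rat_divide del: of_nat_Suc)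
  define near where "near N k \<longleftrightarrow> (\<forall>s t :: rat. s \<noteq> 0 \<and> t \<noteq> 0 \<and> \<bar>of_rat s\<bar> < 1 / real (Suc N) \<and> \<bar>of_rat t\<bar> < 1 / real (Suc N)
        \<longrightarrow> \<bar>q (of_rat s) - q (of_rat t)\<bar> \<le> 1 / real (Suc k))" for N k
  have C': "\<exists>N. near N k" for k using C unfolding near_def by (rule spec)
  have inv: "real_of_rat (1 / of_nat (Suc n)) = 1 / real (Suc n)" for n
    by (simp add: of_rat_divide del: of_nat_Suc)
  have ev: "\<bar>q (of_rat s) - X n\<bar> \<le> 1 / real (Suc k)"
    if N: "near N k" and n: "n > N" and s: "s \<noteq> 0" "\<bar>of_rat s\<bar> < 1 / real (Suc N)" for N k n s
  proof -
    have "1 / real (Suc n) < 1 / real (Suc N)" using n by (simp add: field_simps)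
    then have "\<bar>real_of_rat (1 / of_nat (Suc n))\<bar> < 1 / real (Suc N)" unfolding inv by simp
    moreover have "1 / of_nat (Suc n) \<noteq> (0::rat)" by simp
    ultimately show ?thesis using N s unfolding X_eq near_def by blast
  qed
  have "Cauchy X"
  proof (rule metric_CauchyI)
    fix e :: real assume e: "e > 0"
    obtain k where k: "1 / real (Suc k) < e" by (rule nat_approx_posE[OF e])
    obtain N where N: "near N k" using C' by metis
    have "dist (X m) (X n) < e" if mn: "m \<ge> Suc N" "n \<ge> Suc N" for m n
    proof -
      have "1 / real (Suc m) < 1 / real (Suc N)" using mn by (simp add: field_simps)
      then have "\<bar>real_of_rat (1 / of_nat (Suc m))\<bar> < 1 / real (Suc N)" unfolding inv by simp
      then have "\<bar>X m - X n\<bar> \<le> 1 / real (Suc k)"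
        using mn unfolding X_eq[of m] by (intro ev[OF N]) auto
      then show ?thesis using k unfolding dist_real_def by (rule le_less_trans)
    qed
    then show "\<exists>M. \<forall>m\<ge>M. \<forall>n\<ge>M. dist (X m) (X n) < e" by (intro exI[of _ "Suc N"]) simp
  qed
  then obtain L where L: "X \<longlonglongrightarrow> L" unfolding Cauchy_convergent_iff convergent_def ..
  have "(q \<longlongrightarrow> L) (at 0)"
  proof (rule LIM_I)
    fix e :: real assume e: "e > 0"
    obtain k where k: "1 / real (Suc k) < e" by (rule nat_approx_posE[OF e])
    obtain N where N: "near N k" using C' by metis
    have rat: "\<bar>q (of_rat s) - L\<bar> \<le> 1 / real (Suc k)" if s: "s \<noteq> 0" "\<bar>of_rat s\<bar> < 1 / real (Suc N)" for s
    proof (rule Lim_bounded)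
      show "(\<lambda>n. \<bar>q (of_rat s) - X n\<bar>) \<longlonglongrightarrow> \<bar>q (of_rat s) - L\<bar>"
        by (intro tendsto_rabs tendsto_diff tendsto_const L)
      show "\<forall>n\<ge>Suc N. \<bar>q (of_rat s) - X n\<bar> \<le> 1 / real (Suc k)"
        using ev[OF N _ s] by simp
    qed
    have "\<bar>q h - L\<bar> < e" if h: "h \<noteq> 0" "\<bar>h\<bar> < 1 / real (Suc N)" for h
    proof (rule ccontr)
      assume *: "\<not> \<bar>q h - L\<bar> < e"
      have "isCont q h" using cont h by (simp add: continuous_on_eq_continuous_at open_Compl)
      then have "((\<lambda>x. \<bar>q x - L\<bar>) \<longlongrightarrow> \<bar>q h - L\<bar>) (at h)"
        unfolding isCont_def by (intro tendsto_rabs tendsto_diff tendsto_const)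
      moreover have "1 / real (Suc k) < \<bar>q h - L\<bar>" using * k by simp
      ultimately have "\<forall>\<^sub>F x in at h. 1 / real (Suc k) < \<bar>q x - L\<bar>"
        by (rule order_tendstoD)
      then obtain d where d: "d > 0" "\<And>x. x \<noteq> h \<Longrightarrow> dist x h < d \<Longrightarrow> 1 / real (Suc k) < \<bar>q x - L\<bar>"
        unfolding eventually_at by auto
      \<comment> \<open>A rational within u to the right of h is in the neighbourhood of h, is not 0, and still has absolute value below 1 / Suc N.\<close>
      define u where "u = min d (min (if h < 0 then - h else 1) (1 / real (Suc N) - \<bar>h\<bar>))"
      have u: "u > 0" using d(1) h by (simp add: u_def del: of_nat_Suc)
      obtain r where r: "h < of_rat r" "of_rat r < h + u"
        using of_rat_dense[of h "h + u"] u by auto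
      have "u \<le> d" "h < 0 \<Longrightarrow> u \<le> - h" "u \<le> 1 / real (Suc N) - \<bar>h\<bar>" by (auto simp: u_def)
      with r have r': "dist (of_rat r) h < d" "of_rat r \<noteq> (0::real)" "\<bar>of_rat r\<bar> < 1 / real (Suc N)"
        using h(1) by (auto simp: dist_real_def abs_real_def split: if_splits)
      have "r \<noteq> 0" using r'(2) by auto
      from d(2)[OF _ r'(1)] rat[OF this r'(3)] r(1) show False by auto
    qed
    then show "\<exists>s>0. \<forall>h. h \<noteq> 0 \<and> norm (h - 0) < s \<longrightarrow> norm (q h - L) < e"
      by (intro exI[of _ "1 / real (Suc N)"]) (simp del: of_nat_Suc)
  qed
  then show "\<exists>L. (q \<longlongrightarrow> L) (at 0)" ..
qed

text \<open>
Off the measurable set where the difference quotient converges, \<open>deriv\<close> has one fixed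
unspecified value; on it, \<open>deriv\<close> is the limit of a sequence of measurable difference quotients.
So \<open>deriv\<close> is Borel, not merely equal almost everywhere to a Borel function, which is what
integration with respect to Lebesgue-Borel measure requires.
\<close>
lemma borel_measurable_deriv_at_zero:
  fixes \<phi> :: "'a \<Rightarrow> real \<Rightarrow> real"
  assumes meas [measurable]: "\<And>h. (\<lambda>p. \<phi> p h) \<in> borel_measurable M"
    and cont: "\<And>p. continuous_on UNIV (\<phi> p)"
  shows "(\<lambda>p. deriv (\<phi> p) 0) \<in> borel_measurable M"
proof -
  define q where "q p h = (\<phi> p h - \<phi> p 0) / h" for p h
  have [measurable]: "(\<lambda>p. q p h) \<in> borel_measurable M" for h unfolding q_def by measurable
  define D where "D p \<longleftrightarrow> (\<exists>L. (q p \<longlongrightarrow> L) (at 0))" for p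
  have "continuous_on (- {0}) (q p)" for p
    unfolding q_def by (intro continuous_intros continuous_on_subset[OF cont]) auto
  from has_limit_at_zero_iff_rational_Cauchy[OF this]
  have [measurable]: "Measurable.pred M D" 
    unfolding D_def[abs_def] by simp
  have der_iff: "(\<phi> p has_field_derivative L) (at 0) \<longleftrightarrow> (q p \<longlongrightarrow> L) (at 0)" for p L
    by (simp add: DERIV_def q_def[abs_def])
  have "deriv (\<phi> p) 0 = (if D p then lim (\<lambda>n. q p (1 / real (Suc n))) else (SOME L::real. False))" for p
  proof (cases "D p")
    case True
    then obtain L where L: "(q p \<longlongrightarrow> L) (at 0)" by (auto simp: D_def)
    then have "deriv (\<phi> p) 0 = L" by (intro DERIV_imp_deriv) (simp add: der_iff)
    moreover have "filterlim (\<lambda>n. 1 / real (Suc n)) (at 0) sequentially"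
      unfolding filterlim_at using lim_1_over_n[where 'a=real, THEN LIMSEQ_Suc] by auto
    from filterlim_compose[OF L this] have "(\<lambda>n. q p (1 / real (Suc n))) \<longlonglongrightarrow> L" .
    ultimately show ?thesis using True limI by metis
  next
    case False
    then have "\<not> (\<phi> p has_field_derivative L) (at 0)" for L by (auto simp: der_iff D_def)
    then show ?thesis using False by (simp add: deriv_def)
  qed
  then show ?thesis by simp
qed

section \<open>Weak limits of uniformly bounded functions\<close>

lemma (in finite_measure) set_integral_abs_le:
  fixes f :: "'a \<Rightarrow> real"
  assumes [measurable]: "A \<in> sets M" "f \<in> borel_measurable M" and "AE x in M. \<bar>f x\<bar> \<le> B" "0 \<le> B"
  shows "\<bar>LINT x:A|M. f x\<bar> \<le> B * measure M A"
proof -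
  have int: "integrable M (\<lambda>x. indicator A x * f x)"
    by (rule integrable_const_bound[where B=B])
       (use assms(3,4) in \<open>auto simp: indicator_def split: if_splits elim!: eventually_mono\<close>)
  have "\<bar>LINT x:A|M. f x\<bar> \<le> (\<integral>x. \<bar>indicator A x * f x\<bar> \<partial>M)"
    unfolding set_lebesgue_integral_def by simp
  also have "\<dots> \<le> (\<integral>x. indicator A x * B \<partial>M)"
  proof (rule integral_mono_AE)
    show "integrable M (\<lambda>x. indicator A x * B)" by (simp add: emeasure_eq_measure)
    show "AE x in M. \<bar>indicator A x * f x\<bar> \<le> indicator A x * B"
      using assms(3) by eventually_elim (auto simp: indicator_def)
  qed (use int in simp)
  also have "\<dots> = B * measure M A" by (simp add: emeasure_eq_measure)
  finally show ?thesis .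
qed

text \<open>
Convergence of the integrals over a \<open>\<pi>\<close>-system extends to all measurable sets by Dynkin's argument.  The
uniform bound allows the interchange with countable disjoint unions (Tannery's theorem), and then
the approximation of \<open>g\<close> by simple functions.
\<close>
lemma (in finite_measure) bounded_weak_limit_from_generator:
  fixes h :: "nat \<Rightarrow> 'a \<Rightarrow> real" and h0 g :: "'a \<Rightarrow> real"
  assumes gen: "sets M = sigma_sets (space M) E" "Int_stable E" "E \<subseteq> Pow (space M)"
    and [measurable]: "\<And>n. h n \<in> borel_measurable M" "h0 \<in> borel_measurable M"
    and hB: "\<And>n. AE x in M. \<bar>h n x\<bar> \<le> B" and h0B: "AE x in M. \<bar>h0 x\<bar> \<le> B"
    and conv: "\<And>A. A \<in> insert (space M) E \<Longrightarrow> (\<lambda>n. LINT x:A|M. h n x) \<longlonglongrightarrow> (LINT x:A|M. h0 x)"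
    and B: "0 \<le> B" and g: "integrable M g"
  shows "(\<lambda>n. \<integral>x. g x * h n x \<partial>M) \<longlonglongrightarrow> (\<integral>x. g x * h0 x \<partial>M)"
proof -
  have int: "integrable M (h n)" "integrable M h0" for n
    using hB[of n] h0B by (auto intro!: integrable_const_bound[where B=B])
  have sint: "set_integrable M A (h n)" "set_integrable M A h0" if "A \<in> sets M" for A n
    using integrable_mult_indicator[OF that int(1)] integrable_mult_indicator[OF that int(2)]
    unfolding set_integrable_def by auto
  have intm: "integrable M (\<lambda>x. f x * u x)"
    if "integrable M f" "u \<in> borel_measurable M" "AE x in M. \<bar>u x\<bar> \<le> B" for f u :: "'a \<Rightarrow> real"
  proof (rule Bochner_Integration.integrable_bound)
    show "integrable M (\<lambda>x. B * f x)" using that(1) by simp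
    show "AE x in M. norm (f x * u x) \<le> norm (B * f x)"
      using that(3)
    proof eventually_elim
      case (elim x)
      then have "\<bar>f x\<bar> * \<bar>u x\<bar> \<le> \<bar>f x\<bar> * B" by (intro mult_left_mono) auto
      then show ?case using B by (simp add: abs_mult mult.commute)
    qed
  qed (use that in measurable)
  have Dynkin: "(\<lambda>n. LINT x:A|M. h n x) \<longlonglongrightarrow> (LINT x:A|M. h0 x)" if "A \<in> sets M" for A
    using gen(2,3) that[unfolded gen(1)]
  proof (induction rule: sigma_sets_induct_disjoint)
    case (basic A)
    then show ?case using conv by auto
  next
    case empty
    then show ?case by (simp add: set_lebesgue_integral_def)
  next
    case (compl A)
    then have A: "A \<in> sets M" using gen(1) by simp
    then have sub: "A \<subseteq> space M" by (rule sets.sets_into_space)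
    have "(LINT x:space M - A|M. u x) = (LINT x:space M|M. u x) - (LINT x:A|M. u x)"
      if "integrable M u" for u :: "'a \<Rightarrow> real"
    proof -
      have "(LINT x:A \<union> (space M - A)|M. u x) = (LINT x:A|M. u x) + (LINT x:space M - A|M. u x)"
        using integrable_mult_indicator[OF A that] integrable_mult_indicator[OF sets.compl_sets[OF A] that]
        by (intro set_integral_Un) (auto simp: set_integrable_def)
      then show ?thesis using sub by (simp add: Un_absorb1)
    qed
    then show ?case using compl(2) conv[of "space M"] int by (auto intro: tendsto_diff)
  next
    case (union A)
    then have A [measurable]: "\<And>i. A i \<in> sets M" using gen(1) by auto
    have disj: "\<And>i j. i \<noteq> j \<Longrightarrow> A i \<inter> A j = {}"
      using union(1) by (auto simp: disjoint_family_on_def)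
    have sum: "(LINT x:(\<Union>i. A i)|M. u x) = (\<Sum>i. (LINT x:(A i)|M. u x))" if "integrable M u" for u :: "'a \<Rightarrow> real"
      using that by (intro lebesgue_integral_countable_add A disj)
        (auto simp: set_integrable_def intro!: integrable_mult_indicator[where f=u, simplified])
    have summ: "summable (\<lambda>k. B * measure M (A k))"
      using A union(1) by (intro summable_mult sums_summable[OF finite_measure_UNION]) auto
    have "((\<lambda>n. \<Sum>k. LINT x:A k|M. h n x) \<longlongrightarrow> (\<Sum>k. LINT x:A k|M. h0 x)) sequentially"
      using tannerys_theorem[OF union(3) always_eventually summ] 
        set_integral_abs_le[OF A _ hB B] by (simp add: split_beta)
    then show ?case using int by (simp add: sum)
  qed
  show ?thesis using g
  proof (induction rule: integrable_induct)
    case (base A c)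
    have "(\<lambda>n. c * (LINT x:A|M. h n x)) \<longlonglongrightarrow> c * (LINT x:A|M. h0 x)"
      by (intro tendsto_intros Dynkin base)
    then show ?case unfolding set_lebesgue_integral_def
      by (simp flip: integral_mult_right_zero add: ac_simps)
  next
    case (add f g)
    then show ?case by (simp add: distrib_right intm hB h0B tendsto_add)
  next
    case (lim f s)
    have bd: "\<bar>(\<integral>x. s i x * u x \<partial>M) - (\<integral>x. f x * u x \<partial>M)\<bar> \<le> B * (\<integral>x. \<bar>s i x - f x\<bar> \<partial>M)"
      if u: "u \<in> borel_measurable M" "AE x in M. \<bar>u x\<bar> \<le> B" for u i
    proof -
      have "(\<integral>x. s i x * u x \<partial>M) - (\<integral>x. f x * u x \<partial>M) = (\<integral>x. (s i x - f x) * u x \<partial>M)"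
        using lim(1,4) u by (simp add: intm left_diff_distrib)
      also have "\<bar>\<dots>\<bar> \<le> (\<integral>x. \<bar>(s i x - f x) * u x\<bar> \<partial>M)" by simp
      also have "\<dots> \<le> (\<integral>x. B * \<bar>s i x - f x\<bar> \<partial>M)"
      proof (rule integral_mono_AE)
        show "integrable M (\<lambda>x. \<bar>(s i x - f x) * u x\<bar>)" "integrable M (\<lambda>x. B * \<bar>s i x - f x\<bar>)"
          using intm[OF Bochner_Integration.integrable_diff[OF lim(1)[of i] lim(4)] u] lim(1)[of i] lim(4)
          by (simp_all del: abs_mult)
        show "AE x in M. \<bar>(s i x - f x) * u x\<bar> \<le> B * \<bar>s i x - f x\<bar>"
          using u(2) by eventually_elim (auto simp: abs_mult mult.commute[of B] intro!: mult_left_mono)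
      qed
      finally show ?thesis by simp
    qed
    have "(\<lambda>i. \<integral>x. \<bar>s i x - f x\<bar> \<partial>M) \<longlonglongrightarrow> (\<integral>x. 0 \<partial>M)"
    proof (rule integral_dominated_convergence[where w="\<lambda>x. 3 * \<bar>f x\<bar>"])
      show "AE x in M. (\<lambda>i. \<bar>s i x - f x\<bar>) \<longlonglongrightarrow> 0"
        by (intro AE_I2 tendsto_rabs_zero LIM_zero lim(2))
      show "AE x in M. norm \<bar>s i x - f x\<bar> \<le> 3 * \<bar>f x\<bar>" for i
      proof (rule AE_I2)
        fix x assume "x \<in> space M"
        from lim(3)[OF this, of i] show "norm \<bar>s i x - f x\<bar> \<le> 3 * \<bar>f x\<bar>" by simp
      qed
    qed (use lim(1,4) in auto)
    then have "(\<lambda>i. B * (\<integral>x. \<bar>s i x - f x\<bar> \<partial>M)) \<longlonglongrightarrow> 0"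
      using tendsto_mult_left[of _ "0::real" sequentially B] by simp
    from order_tendstoD(2)[OF this]
    have small: "\<exists>i. B * (\<integral>x. \<bar>s i x - f x\<bar> \<partial>M) < e" if "e > 0" for e
      using that by (auto simp: eventually_sequentially)
    show ?case
    proof (rule LIMSEQ_I)
      fix e :: real assume "e > 0"
      then obtain i where i: "B * (\<integral>x. \<bar>s i x - f x\<bar> \<partial>M) < e / 3" using small[of "e / 3"] by auto
      obtain N where N: "\<And>n. n \<ge> N \<Longrightarrow> norm ((\<integral>x. s i x * h n x \<partial>M) - (\<integral>x. s i x * h0 x \<partial>M)) < e / 3"
        using LIMSEQ_D[OF lim(5)[of i], of "e / 3"] \<open>e > 0\<close> by auto
      have "norm ((\<integral>x. f x * h n x \<partial>M) - (\<integral>x. f x * h0 x \<partial>M)) < e" if "n \<ge> N" for n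
      proof -
        have tri: "\<bar>c - d\<bar> < e" if "\<bar>a - b\<bar> < e / 3" "\<bar>a - c\<bar> < e / 3" "\<bar>b - d\<bar> < e / 3" for a b c d :: real
          using that by linarith
        show ?thesis unfolding real_norm_def
          by (rule tri) (use N[OF that] in simp, (rule le_less_trans[OF bd i]; use hB h0B in simp)+)
      qed
      then show "\<exists>no. \<forall>n\<ge>no. norm ((\<integral>x. f x * h n x \<partial>M) - (\<integral>x. f x * h0 x \<partial>M)) < e" by blast
    qed
  qed
qed

section \<open>Monotone functions with difference quotients at most 1\<close>

text \<open>
The regularity that the sections of a copula have: increasing and 1-Lipschitz.
\<close>
definition unit_slope :: "(real \<Rightarrow> real) \<Rightarrow> bool" where
  "unit_slope f \<longleftrightarrow> (\<forall>x y. x \<le> y \<longrightarrow> f x \<le> f y \<and> f y - f x \<le> y - x)"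

lemma unit_slope_abs: "unit_slope f \<Longrightarrow> \<bar>f x - f y\<bar> \<le> \<bar>x - y\<bar>"
  unfolding unit_slope_def by (smt (verit))

lemma unit_slope_continuous: "unit_slope f \<Longrightarrow> continuous_on UNIV f"
  by (rule lipschitz_on_continuous_on[of 1])
     (auto intro!: lipschitz_onI simp: dist_real_def dest: unit_slope_abs)

lemma unit_slope_deriv_bounds:
  assumes "unit_slope f" "(f has_real_derivative d) (at x)"
  shows "0 \<le> d" "d \<le> 1"
proof -
  have lim: "((\<lambda>h. (f (x + h) - f x) / h) \<longlongrightarrow> d) (at 0)"
    using assms(2) by (simp add: DERIV_def)
  have q: "0 \<le> (f (x + h) - f x) / h \<and> (f (x + h) - f x) / h \<le> 1" if "h \<noteq> 0" for h
  proof (cases "h > 0")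
    case True
    then have "0 \<le> f (x + h) - f x" "f (x + h) - f x \<le> h"
      using assms(1) unfolding unit_slope_def by (smt (verit))+
    then show ?thesis using True by (simp add: divide_simps)
  next
    case False
    then have "f (x + h) - f x \<le> 0" "h \<le> f (x + h) - f x"
      using assms(1) unfolding unit_slope_def by (smt (verit))+
    then show ?thesis using False that by (simp add: divide_simps)
  qed
  show "0 \<le> d"
    by (rule tendsto_lowerbound[OF lim]) (auto simp: eventually_at_filter q)
  show "d \<le> 1"
    by (rule tendsto_upperbound[OF lim]) (auto simp: eventually_at_filter q)
qed

text \<open>
Used to compare the Stieltjes measures of two functions with that of their sum.
\<close>
lemma measure_sum_exists:
  assumes "sets M = sets N"
  shows "\<exists>K. sets K = sets M \<and> (\<forall>A\<in>sets M. emeasure K A = emeasure M A + emeasure N A)"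
proof -
  define K where "K = measure_of (space M) (sets M) (\<lambda>A. emeasure M A + emeasure N A)"
  have "countably_additive (sets M) (\<lambda>A. emeasure M A + emeasure N A)"
  proof (rule countably_additiveI)
    fix A :: "nat \<Rightarrow> _" assume A: "range A \<subseteq> sets M" "disjoint_family A"
    then show "(\<Sum>i. emeasure M (A i) + emeasure N (A i)) = emeasure M (\<Union> (range A)) + emeasure N (\<Union> (range A))"
      using assms by (subst suminf_add[symmetric]) (auto simp: suminf_emeasure)
  qed
  then have "emeasure K A = emeasure M A + emeasure N A" if "A \<in> sets M" for A
    unfolding K_def using that
    by (intro emeasure_measure_of_sigma) (auto simp: positive_def sets.sigma_algebra_axioms)
  moreover have "sets K = sets M" unfolding K_def by simp
  ultimately show ?thesis by blast
qed

lemma unit_slope_complement: "unit_slope f \<Longrightarrow> unit_slope (\<lambda>x. x - f x)"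
  unfolding unit_slope_def by (smt (verit))

lemma unit_slope_Ioc:
  assumes "unit_slope f" "a \<le> b"
  shows "emeasure (interval_measure f) {a<..b} = ennreal (f b - f a)"
  using assms unit_slope_continuous[OF assms(1)]
  by (intro emeasure_interval_measure_Ioc)
     (auto simp: unit_slope_def continuous_on_eq_continuous_within intro: continuous_within_subset)

lemma unit_slope_Icc:
  assumes "unit_slope f" "a \<le> b"
  shows "emeasure (interval_measure f) {a..b} = ennreal (f b - f a)"
  using assms unit_slope_continuous[OF assms(1)]
  by (intro emeasure_interval_measure_Icc) (auto simp: unit_slope_def)

text \<open>
Both \<open>f\<close> and \<open>\<lambda>x. x - f x\<close> are increasing, and their Stieltjes measures add up to Lebesgue
measure.  So the measure of \<open>f\<close> is dominated by Lebesgue measure.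
\<close>
lemma unit_slope_absolutely_continuous:
  assumes f: "unit_slope f"
  shows "absolutely_continuous lborel (interval_measure f)"
proof -
  let ?g = "\<lambda>x. x - f x"
  obtain K where K: "sets K = sets borel" "\<And>A. A \<in> sets borel \<Longrightarrow>
      emeasure K A = emeasure (interval_measure f) A + emeasure (interval_measure ?g) A"
    using measure_sum_exists[of "interval_measure f" "interval_measure ?g"] by auto
  have box: "emeasure K {a<..<b} = ennreal (b - a)" if "a \<le> b" for a b
  proof (cases "a = b")
    case False
    have pt: "emeasure (interval_measure h) {b} = 0" if "unit_slope h" for h
      using unit_slope_Icc[OF that, of b b] by simp
    have "emeasure (interval_measure h) {a<..<b} = ennreal (h b - h a)" if h: "unit_slope h" for h
    proof -
      have "{a<..b} = {a<..<b} \<union> {b}" using \<open>a \<le> b\<close> False by auto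
      moreover have "emeasure (interval_measure h) ({a<..<b} \<union> {b}) = 
          emeasure (interval_measure h) {a<..<b} + emeasure (interval_measure h) {b}"
        by (intro plus_emeasure[symmetric]) auto
      ultimately show ?thesis using pt[OF h] unit_slope_Ioc[OF h \<open>a \<le> b\<close>] by simp
    qed
    then show ?thesis using f unit_slope_complement[OF f] that
      by (subst K(2)) (auto simp: ennreal_plus[symmetric] unit_slope_def simp del: ennreal_plus)
  qed (simp add: K(2))
  have "lborel = K"
    by (rule lborel_eqI) (auto simp: K(1) box box_real)
  then show ?thesis
    unfolding absolutely_continuous_def using K by (auto simp: null_sets_def)
qed

text \<open>
The density is the Radon-Nikodym derivative of the Stieltjes measure of \<open>f\<close>.
\<close>
lemma unit_slope_density:
  assumes f: "unit_slope f"
  obtains g where "g \<in> borel_measurable borel" "\<And>x. 0 \<le> g x"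
    "\<And>a b. a \<le> b \<Longrightarrow> (g has_integral (f b - f a)) {a..b}"
proof -
  let ?N = "interval_measure f"
  have sf: "sigma_finite_measure ?N"
    using f unit_slope_continuous[OF f]
    by (intro sigma_finite_interval_measure)
       (auto simp: unit_slope_def continuous_on_eq_continuous_within intro: continuous_within_subset)
  let ?r = "RN_deriv lborel ?N"
  have fin: "AE x in lborel. ?r x \<noteq> \<infinity>"
    by (rule sigma_finite_measure.RN_deriv_finite[OF sigma_finite_lborel sf])
       (auto simp: unit_slope_absolutely_continuous[OF f])
  have dens: "density lborel ?r = ?N"
    by (rule sigma_finite_measure.density_RN_deriv[OF sigma_finite_lborel])
       (auto simp: unit_slope_absolutely_continuous[OF f])
  define g where "g x = enn2real (?r x)" for x
  have [measurable]: "g \<in> borel_measurable borel" unfolding g_def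
    using borel_measurable_RN_deriv[of lborel ?N] by (auto)
  have "(g has_integral (f b - f a)) {a..b}" if "a \<le> b" for a b
  proof -
    have "(\<integral>\<^sup>+x. ennreal (g x * indicator {a..b} x) \<partial>lborel) = (\<integral>\<^sup>+x. ?r x * indicator {a..b} x \<partial>lborel)"
      using fin by (intro nn_integral_cong_AE) (auto simp: g_def indicator_def less_top)
    also have "\<dots> = emeasure (density lborel ?r) {a..b}"
      by (subst emeasure_density) auto
    also have "\<dots> = ennreal (f b - f a)" using dens unit_slope_Icc[OF f that] by simp
    finally have *: "(\<integral>\<^sup>+x. ennreal (g x * indicator {a..b} x) \<partial>lborel) = ennreal (f b - f a)" .
    have "((\<lambda>x. g x * indicator {a..b} x) has_integral (f b - f a)) UNIV"
      using * f that by (intro nn_integral_has_integral) (auto simp: g_def unit_slope_def)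
    moreover have "(\<lambda>x. g x * indicator {a..b} x) = (\<lambda>x. if x \<in> {a..b} then g x else 0)"
      by (auto simp: indicator_def)
    ultimately show ?thesis by (simp only: has_integral_restrict_UNIV)
  qed
  then show thesis using that[of g] by (auto simp: g_def)
qed

text \<open>
Lebesgue differentiation from the right, the one-dimensional case of
\<open>integrable_ccontinuous_explicit\<close>.
\<close>
lemma right_derivative_of_integral_AE:
  fixes g :: "real \<Rightarrow> real"
  assumes "\<And>a b. g integrable_on {a..b}"
  obtains N where "negligible N" "\<And>x e. x \<notin> N \<Longrightarrow> e > 0 \<Longrightarrow>
     \<exists>d>0. \<forall>h. 0 < h \<and> h < d \<longrightarrow> \<bar>integral {x..x + h} g / h - g x\<bar> < e"
  using integrable_ccontinuous_explicit[of g] assms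
  by (auto simp: divide_inverse mult.commute)

text \<open>
Lebesgue differentiation from the right applied to the density \<open>g\<close> gives the right derivative;
applied to the reflected density \<open>\<lambda>x. g (- x)\<close> it gives the left one.
\<close>
lemma unit_slope_differentiable_AE:
  assumes f: "unit_slope f"
  obtains g where "\<And>a b. a \<le> b \<Longrightarrow> (g has_integral (f b - f a)) {a..b}"
    "AE x in lborel. (f has_real_derivative g x) (at x)"
proof -
  obtain g where g: "\<And>a b. a \<le> b \<Longrightarrow> (g has_integral (f b - f a)) {a..b}"
    using unit_slope_density[OF f] by metis
  have g_refl: "((\<lambda>x. g (- x)) has_integral (f b - f a)) {-b..-a}" if "a \<le> b" for a b
    using g[OF that] by (subst has_integral_reflect_real)
  have int: "g integrable_on {a..b}" "(\<lambda>x. g (- x)) integrable_on {a..b}" for a b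
    using g[of a b] g_refl[of "-b" "-a"] 
    by (cases "a \<le> b"; force simp: integrable_on_def)+
  obtain N1 where N1: "negligible N1" "\<And>x e. x \<notin> N1 \<Longrightarrow> e > 0 \<Longrightarrow>
     \<exists>d>0. \<forall>h. 0 < h \<and> h < d \<longrightarrow> \<bar>integral {x..x + h} g / h - g x\<bar> < e"
    using right_derivative_of_integral_AE[OF int(1)] by metis
  obtain N2 where N2: "negligible N2" "\<And>x e. x \<notin> N2 \<Longrightarrow> e > 0 \<Longrightarrow>
     \<exists>d>0. \<forall>h. 0 < h \<and> h < d \<longrightarrow> \<bar>integral {x..x + h} (\<lambda>x. g (- x)) / h - g (- x)\<bar> < e"
    using right_derivative_of_integral_AE[OF int(2)] by metis
  have der: "(f has_real_derivative g x) (at x)" if x: "x \<notin> N1" "- x \<notin> N2" for x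
    unfolding DERIV_def
  proof (rule LIM_I)
    fix e :: real assume e: "e > 0"
    obtain d1 where d1: "d1 > 0" "\<And>h. 0 < h \<Longrightarrow> h < d1 \<Longrightarrow> \<bar>integral {x..x + h} g / h - g x\<bar> < e"
      using N1(2)[OF x(1) e] by auto
    obtain d2 where d2: "d2 > 0" "\<And>h. 0 < h \<Longrightarrow> h < d2 \<Longrightarrow>
        \<bar>integral {- x..- x + h} (\<lambda>x. g (- x)) / h - g x\<bar> < e"
      using N2(2)[OF x(2) e] by auto
    have "norm ((f (x + h) - f x) / h - g x) < e" if h: "h \<noteq> 0" "norm (h - 0) < min d1 d2" for h
    proof (cases "h > 0")
      case True
      then have "integral {x..x + h} g = f (x + h) - f x"
        by (intro integral_unique g) auto
      then show ?thesis using d1(2)[of h] True h by simp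
    next
      case False
      then have "integral {- x..- x - h} (\<lambda>x. g (- x)) = f x - f (x + h)"
        using g_refl[of "x + h" x] by (intro integral_unique) auto
      moreover have "(f x - f (x + h)) / (- h) = (f (x + h) - f x) / h"
        using h by (simp add: field_simps)
      ultimately show ?thesis using d2(2)[of "- h"] False h by simp
    qed
    then show "\<exists>s>0. \<forall>h. h \<noteq> 0 \<and> norm (h - 0) < s \<longrightarrow> norm ((f (x + h) - f x) / h - g x) < e"
      using d1(1) d2(1) by (intro exI[of _ "min d1 d2"]) auto
  qed
  have "negligible (uminus ` N2)"
    by (rule negligible_differentiable_image_negligible[OF order_refl N2(1)])
       (auto intro!: derivative_intros)
  with N1(1) have "negligible (N1 \<union> uminus ` N2)" by (rule negligible_Un)
  then have "AE x in lebesgue. x \<notin> N1 \<union> uminus ` N2"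
    by (intro AE_not_in) (simp add: negligible_iff_null_sets)
  then have "AE x in lborel. x \<notin> N1 \<union> uminus ` N2"
    by (simp only: AE_completion_iff)
  then have "AE x in lborel. (f has_real_derivative g x) (at x)"
    by eventually_elim (rule der, force+)
  then show thesis using that g by blast
qed

lemma borel_measurable_deriv:
  fixes f :: "real \<Rightarrow> real"
  assumes "continuous_on UNIV f"
  shows "deriv f \<in> borel_measurable borel"
proof -
  have "(\<lambda>x. deriv (\<lambda>h. f (x + h)) 0) \<in> borel_measurable borel"
    using assms by (intro borel_measurable_deriv_at_zero borel_measurable_continuous_onI)
      (auto intro!: continuous_intros continuous_on_compose2[OF assms])
  then show ?thesis by (subst deriv_shift_0[abs_def]) (simp add: comp_def)
qed

lemma unit_slope_deriv_measurable [measurable (raw)]: "unit_slope f \<Longrightarrow> deriv f \<in> borel_measurable borel"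
  by (intro borel_measurable_deriv unit_slope_continuous)

lemma unit_slope_has_deriv_AE:
  assumes "unit_slope f"
  shows "AE x in lborel. (f has_real_derivative deriv f x) (at x)"
proof -
  obtain g where "AE x in lborel. (f has_real_derivative g x) (at x)"
    by (rule unit_slope_differentiable_AE[OF assms])
  then show ?thesis by eventually_elim (simp add: DERIV_imp_deriv)
qed

lemma unit_slope_deriv_bounds_AE:
  assumes "unit_slope f"
  shows "AE x in lborel. 0 \<le> deriv f x \<and> deriv f x \<le> 1"
  using unit_slope_has_deriv_AE[OF assms]
  by eventually_elim (auto dest: unit_slope_deriv_bounds[OF assms])

text \<open>
The fundamental theorem of calculus: the density of \<open>f\<close> and \<open>deriv f\<close> agree almost everywhere.
\<close>
lemma unit_slope_set_integral_deriv:
  assumes f: "unit_slope f" and ab: "a \<le> b"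
  shows "(LINT x:{a..b}|lborel. deriv f x) = f b - f a"
proof -
  obtain g where g: "(g has_integral (f b - f a)) {a..b}" "AE x in lborel. (f has_real_derivative g x) (at x)"
    using unit_slope_differentiable_AE[OF f] ab by metis
  \<comment> \<open>The density of f agrees with deriv f off a Lebesgue null set, which does not affect Henstock-Kurzweil integrals.\<close>
  have "AE x in lebesgue. deriv f x = g x"
    by (subst AE_completion_iff, use g(2) in eventually_elim) (rule DERIV_imp_deriv)
  then obtain N where N: "negligible N" "{x. deriv f x \<noteq> g x} \<subseteq> N"
    unfolding negligible_iff_null_sets by (elim AE_E3) auto
  have "(deriv f has_integral (f b - f a)) {a..b}"
    by (rule has_integral_spike[OF N(1) _ g(1)]) (use N(2) in auto)
  moreover have "set_integrable lborel {a..b} (deriv f)"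
    unfolding set_integrable_def
  proof (rule Bochner_Integration.integrable_bound)
    show "integrable lborel (indicator {a..b} :: real \<Rightarrow> real)"
      by (rule integrable_real_indicator) (auto simp: emeasure_lborel_Icc_eq)
    show "AE x in lborel. norm (indicat_real {a..b} x *\<^sub>R deriv f x) \<le> norm (indicat_real {a..b} x)"
      using unit_slope_deriv_bounds_AE[OF f] by eventually_elim (auto simp: indicator_def)
  qed (use f in measurable)
  from set_borel_integral_eq_integral[OF this] have "(LINT x:{a..b}|lborel. deriv f x) = integral {a..b} (deriv f)"
    by simp
  ultimately show ?thesis by (simp add: integral_unique)
qed

section \<open>Weak and strong convergence of derivatives on the unit interval\<close>

text \<open>
Lebesgue measure on the open unit interval, realised as a density rather than a restriction: its
sets are then all Borel sets of the line, and functions on the line stay measurable unchanged.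
\<close>
definition unit_lborel :: "real measure" where
  "unit_lborel = density lborel (\<lambda>x. ennreal (indicator {0<..<1} x))"

lemma sets_unit_lborel [simp, measurable_cong]: "sets unit_lborel = sets borel"
  by (simp add: unit_lborel_def)

lemma space_unit_lborel [simp]: "space unit_lborel = UNIV"
  by (simp add: unit_lborel_def)

lemma finite_measure_unit_lborel: "finite_measure unit_lborel"
  by (rule finite_measureI) (simp add: unit_lborel_def emeasure_density ennreal_indicator)

interpretation unit_lborel: finite_measure unit_lborel
  by (rule finite_measure_unit_lborel)

lemma AE_unit_lborel_iff: "(AE x in unit_lborel. P x) \<longleftrightarrow> (AE x in lborel. x \<in> {0<..<1} \<longrightarrow> P x)"
  unfolding unit_lborel_def by (subst AE_density) (auto simp: indicator_def intro!: AE_cong)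

lemma AE_unit_lborelI: "(AE x in lborel. P x) \<Longrightarrow> (AE x in unit_lborel. x \<in> {0<..<1} \<and> P x)"
  by (auto simp: AE_unit_lborel_iff elim: eventually_mono)

lemma integral_unit_lborel:
  fixes f :: "real \<Rightarrow> real"
  assumes [measurable]: "f \<in> borel_measurable borel"
  shows "(\<integral>x. f x \<partial>unit_lborel) = (LINT x:{0<..<1}|lborel. f x)"
  unfolding unit_lborel_def set_lebesgue_integral_def by (subst integral_density) auto

lemma set_integral_unit_lborel_deriv:
  assumes f: "unit_slope f" and "a \<le> b"
  shows "(LINT x:{a<..b}|unit_lborel. deriv f x) = f (max 0 (min 1 b)) - f (max 0 (min 1 a))"
proof -
  define a' b' where "a' = max 0 (min 1 a)" and "b' = max 0 (min 1 b)"
  have le: "a' \<le> b'" using assms(2) by (auto simp: a'_def b'_def)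
  have "(LINT x:{a<..b}|unit_lborel. deriv f x) = (LINT x:{0<..<1}|lborel. indicator {a<..b} x * deriv f x)"
    using f unfolding set_lebesgue_integral_def real_scaleR_def
    by (intro integral_unit_lborel[unfolded set_lebesgue_integral_def real_scaleR_def]) measurable
  also have "\<dots> = (LINT x:{a'..b'}|lborel. deriv f x)"
    unfolding set_lebesgue_integral_def
  proof (rule integral_cong_AE)
    have "AE x in lborel. x \<notin> {a', b', 0, 1, a, b}" 
      by (intro AE_not_in) (auto intro: finite_imp_null_set_lborel)
    then show "AE x in lborel. indicat_real {0<..<1} x *\<^sub>R (indicat_real {a<..b} x * deriv f x) = indicat_real {a'..b'} x *\<^sub>R deriv f x"
      by eventually_elim (auto simp: indicator_def a'_def b'_def min_def max_def split: if_splits)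
  qed (use f in measurable)
  also have "\<dots> = f b' - f a'" by (rule unit_slope_set_integral_deriv[OF f le])
  finally show ?thesis by (simp add: a'_def b'_def)
qed

lemma integral_unit_lborel_deriv:
  assumes f: "unit_slope f"
  shows "(\<integral>x. deriv f x \<partial>unit_lborel) = f 1 - f 0"
proof -
  have "(\<integral>x. deriv f x \<partial>unit_lborel) = (LINT x:{0<..1}|unit_lborel. deriv f x)"
    unfolding set_lebesgue_integral_def
  proof (rule integral_cong_AE)
    have "AE x in unit_lborel. x \<in> {0<..<1}" by (simp add: AE_unit_lborel_iff)
    then show "AE x in unit_lborel. deriv f x = indicat_real {0<..1} x *\<^sub>R deriv f x"
      by eventually_elim simp
  qed (use f in measurable)
  then show ?thesis by (simp add: set_integral_unit_lborel_deriv[OF f])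
qed

text \<open>
Half-open intervals form a \<open>\<pi>\<close>-system on which, by the fundamental theorem, the integral of a
derivative is a difference of two values, and these converge by assumption.
\<close>
lemma unit_slope_deriv_weak_limit:
  assumes F: "\<And>n. unit_slope (F n)" and f: "unit_slope f"
    and lim: "\<And>x. x \<in> {0..1} \<Longrightarrow> (\<lambda>n. F n x) \<longlonglongrightarrow> f x"
    and g: "integrable unit_lborel g"
  shows "(\<lambda>n. \<integral>x. g x * deriv (F n) x \<partial>unit_lborel) \<longlonglongrightarrow> (\<integral>x. g x * deriv f x \<partial>unit_lborel)"
proof (rule unit_lborel.bounded_weak_limit_from_generator[where B=1 and E="range (\<lambda>(a, b). {a<..b})"])
  show "sets unit_lborel = sigma_sets (space unit_lborel) (range (\<lambda>(a::real, b). {a<..b}))"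
    by (simp add: borel_sigma_sets_Ioc)
  show "Int_stable (range (\<lambda>(a::real, b). {a<..b}))"
  proof (rule Int_stableI_image)
    fix p q :: "real \<times> real"
    have "{fst p<..snd p} \<inter> {fst q<..snd q} = {max (fst p) (fst q)<..min (snd p) (snd q)}" by auto
    then show "\<exists>r\<in>UNIV. (case p of (a, b) \<Rightarrow> {a<..b}) \<inter> (case q of (a, b) \<Rightarrow> {a<..b}) = (case r of (a, b) \<Rightarrow> {a<..b})"
      by (auto simp: split_beta)
  qed
  have bd: "AE x in unit_lborel. \<bar>deriv h x\<bar> \<le> 1" if "unit_slope h" for h
    using AE_unit_lborelI[OF unit_slope_deriv_bounds_AE[OF that]] by eventually_elim auto
  show "AE x in unit_lborel. \<bar>deriv (F n) x\<bar> \<le> 1" for n by (rule bd[OF F])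
  show "AE x in unit_lborel. \<bar>deriv f x\<bar> \<le> 1" by (rule bd[OF f])
  show "(\<lambda>n. LINT x:A|unit_lborel. deriv (F n) x) \<longlonglongrightarrow> (LINT x:A|unit_lborel. deriv f x)"
    if "A \<in> insert (space unit_lborel) (range (\<lambda>(a, b). {a<..b}))" for A
    using that
  proof
    assume "A = space unit_lborel"
    then show ?thesis
      using F f lim by (simp add: set_lebesgue_integral_def integral_unit_lborel_deriv tendsto_diff)
  next
    assume "A \<in> range (\<lambda>(a, b). {a<..b})"
    then obtain a b where A: "A = {a<..b}" by auto
    show ?thesis
    proof (cases "a \<le> b")
      case True
      then show ?thesis unfolding A using F f
        by (simp add: set_integral_unit_lborel_deriv) (intro tendsto_diff lim; auto)
    qed (simp add: A set_lebesgue_integral_def)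
  qed
qed (use F f g in auto)

text \<open>
Write \<open>c\<close> and \<open>d\<close> for the derivatives of \<open>f\<close> and \<open>F n\<close>.  As \<open>(c - d)\<^sup>2 \<le> c + d - 2 * c * d\<close>, the
integral in question is bounded by an expression that converges, by weak convergence with weight
\<open>c\<close>, to twice the integral of \<open>c - c\<^sup>2\<close>, which is 0 by the assumption \<open>extreme\<close>.
\<close>
lemma unit_slope_deriv_strong_limit:
  assumes F: "\<And>n. unit_slope (F n)" and f: "unit_slope f"
    and lim: "\<And>x. x \<in> {0..1} \<Longrightarrow> (\<lambda>n. F n x) \<longlonglongrightarrow> f x"
    and extreme: "(\<integral>x. (deriv f x)\<^sup>2 \<partial>unit_lborel) = f 1 - f 0"
  shows "(\<lambda>n. \<integral>x. (deriv (\<lambda>s. f s - F n s) x)\<^sup>2 \<partial>unit_lborel) \<longlonglongrightarrow> 0"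
proof -
  have bd: "AE x in unit_lborel. 0 \<le> deriv h x \<and> deriv h x \<le> 1" if "unit_slope h" for h
    using AE_unit_lborelI[OF unit_slope_deriv_bounds_AE[OF that]] by eventually_elim auto
  have der: "AE x in unit_lborel. (h has_real_derivative deriv h x) (at x)" if "unit_slope h" for h
    using AE_unit_lborelI[OF unit_slope_has_deriv_AE[OF that]] by eventually_elim auto
  have int: "integrable unit_lborel (deriv h)" if "unit_slope h" for h
  proof (rule unit_lborel.integrable_const_bound[where B=1])
    show "AE x in unit_lborel. norm (deriv h x) \<le> 1"
      using bd[OF that] by eventually_elim simp
  qed (use that in measurable)
  have intp: "integrable unit_lborel (\<lambda>x. deriv h x * deriv k x)" if h: "unit_slope h" "unit_slope k" for h k
  proof (rule unit_lborel.integrable_const_bound[where B=1])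
    show "AE x in unit_lborel. norm (deriv h x * deriv k x) \<le> 1"
      using bd[OF h(1)] bd[OF h(2)] by eventually_elim (auto simp: abs_mult intro: mult_le_one)
  qed (use h in measurable)
  have le: "(\<integral>x. (deriv (\<lambda>s. f s - F n s) x)\<^sup>2 \<partial>unit_lborel) \<le> 
     (f 1 - f 0) + (F n 1 - F n 0) - 2 * (\<integral>x. deriv f x * deriv (F n) x \<partial>unit_lborel)" for n
  proof -
    have "(\<integral>x. (deriv (\<lambda>s. f s - F n s) x)\<^sup>2 \<partial>unit_lborel)
       \<le> (\<integral>x. deriv f x + deriv (F n) x - 2 * (deriv f x * deriv (F n) x) \<partial>unit_lborel)"
    proof (rule integral_mono_AE')
      show "integrable unit_lborel (\<lambda>x. deriv f x + deriv (F n) x - 2 * (deriv f x * deriv (F n) x))"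
        using int[OF f] int[OF F] intp[OF f F] by auto
      have *: "(c - d)\<^sup>2 \<le> c + d - 2 * (c * d)" if "0 \<le> c" "c \<le> 1" "0 \<le> d" "d \<le> 1" for c d :: real
      proof -
        have "c * c \<le> c" "d * d \<le> d" using that by (auto intro: mult_left_le)
        then show ?thesis by (simp add: power2_eq_square algebra_simps)
      qed
      show "AE x in unit_lborel. (deriv (\<lambda>s. f s - F n s) x)\<^sup>2 \<le> deriv f x + deriv (F n) x - 2 * (deriv f x * deriv (F n) x)"
        using bd[OF f] bd[OF F[of n]] der[OF f] der[OF F[of n]]
      proof eventually_elim
        case (elim x)
        have "deriv (\<lambda>s. f s - F n s) x = deriv f x - deriv (F n) x"
          by (intro DERIV_imp_deriv DERIV_diff elim)
        then show ?case using *[of "deriv f x" "deriv (F n) x"] elim by simp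
      qed
      then show "AE x in unit_lborel. 0 \<le> deriv f x + deriv (F n) x - 2 * (deriv f x * deriv (F n) x)"
        by eventually_elim (meson order_trans zero_le_power2)
    qed
    also have "\<dots> = (f 1 - f 0) + (F n 1 - F n 0) - 2 * (\<integral>x. deriv f x * deriv (F n) x \<partial>unit_lborel)"
      using int[OF f] int[OF F] intp[OF f F]
      by (simp add: integral_unit_lborel_deriv f F)
    finally show ?thesis .
  qed
  have "(\<lambda>n. (f 1 - f 0) + (F n 1 - F n 0) - 2 * (\<integral>x. deriv f x * deriv (F n) x \<partial>unit_lborel))
     \<longlonglongrightarrow> (f 1 - f 0) + (f 1 - f 0) - 2 * (\<integral>x. deriv f x * deriv f x \<partial>unit_lborel)"
    by (intro tendsto_intros lim unit_slope_deriv_weak_limit F f int) auto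
  then have lim0: "(\<lambda>n. (f 1 - f 0) + (F n 1 - F n 0) - 2 * (\<integral>x. deriv f x * deriv (F n) x \<partial>unit_lborel)) \<longlonglongrightarrow> 0"
    using extreme by (simp add: power2_eq_square)
  show ?thesis
    by (rule tendsto_sandwich[OF always_eventually always_eventually tendsto_const lim0]) (auto intro: le)
qed

section \<open>The Sobolev norm as a sum of two directional energies\<close>

text \<open>
This class contains the extensions of copulas and the differences of two such extensions, and it
provides both joint continuity and bounds for the partial derivatives.
\<close>
definition l1_lipschitz :: "(real \<Rightarrow> real \<Rightarrow> real) \<Rightarrow> bool" where
  "l1_lipschitz A \<longleftrightarrow> (\<forall>x x' y y'. \<bar>A x y - A x' y'\<bar> \<le> \<bar>x - x'\<bar> + \<bar>y - y'\<bar>)"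

lemma l1_lipschitz_transpose: "l1_lipschitz A \<Longrightarrow> l1_lipschitz (\<lambda>x y. A y x)"
  unfolding l1_lipschitz_def by (subst add.commute) blast

lemma l1_lipschitz_section: "l1_lipschitz A \<Longrightarrow> \<bar>A x y - A x' y\<bar> \<le> \<bar>x - x'\<bar>"
  unfolding l1_lipschitz_def by (drule spec[of _ x], drule spec[of _ x'], drule spec[of _ y], drule spec[of _ y]) simp

lemma l1_lipschitz_continuous:
  assumes "l1_lipschitz A"
  shows "continuous_on UNIV (\<lambda>p. A (fst p) (snd p))"
proof (rule lipschitz_on_continuous_on[of 2], rule lipschitz_onI)
  fix p q :: "real \<times> real"
  have "\<bar>A (fst p) (snd p) - A (fst q) (snd q)\<bar> \<le> dist (fst p) (fst q) + dist (snd p) (snd q)"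
    using assms unfolding l1_lipschitz_def dist_real_def by blast
  also have "\<dots> \<le> 2 * dist p q" using dist_fst_le[of p q] dist_snd_le[of p q] by simp
  finally show "dist (A (fst p) (snd p)) (A (fst q) (snd q)) \<le> 2 * dist p q"
    by (simp add: dist_real_def)
qed simp

lemma l1_lipschitz_partial_deriv_measurable:
  assumes A: "l1_lipschitz A"
  shows "(\<lambda>p. deriv (\<lambda>s. A s (snd p)) (fst p)) \<in> borel_measurable (borel \<Otimes>\<^sub>M borel)"
proof -
  have "(\<lambda>p. deriv (\<lambda>h. A (fst p + h) (snd p)) 0) \<in> borel_measurable (borel :: (real \<times> real) measure)"
  proof (rule borel_measurable_deriv_at_zero)
    show "(\<lambda>p. A (fst p + h) (snd p)) \<in> borel_measurable borel" for h
      by (intro borel_measurable_continuous_onI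
            continuous_on_compose2[OF l1_lipschitz_continuous[OF A], where f="\<lambda>p. (fst p + h, snd p)", simplified])
         (auto intro!: continuous_intros)
    show "continuous_on UNIV (\<lambda>h. A (fst p + h) (snd p))" for p :: "real \<times> real"
      by (intro continuous_on_compose2[OF l1_lipschitz_continuous[OF A], where f="\<lambda>h. (fst p + h, snd p)", simplified])
         (auto intro!: continuous_intros)
  qed
  moreover have "deriv (\<lambda>s. A s (snd p)) (fst p) = deriv (\<lambda>h. A (fst p + h) (snd p)) 0" for p
    by (subst deriv_shift_0) (simp add: comp_def)
  ultimately show ?thesis by (simp add: borel_prod)
qed

text \<open>
The bound \<open>K\<close> must also cover the unspecified value of \<open>deriv\<close> at points without a derivative;
that value does not depend on the function.
\<close>
lemma nonexpansive_deriv_bound: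
  "\<exists>K\<ge>0. \<forall>f :: real \<Rightarrow> real. (\<forall>x y. \<bar>f x - f y\<bar> \<le> \<bar>x - y\<bar>) \<longrightarrow> (\<forall>x. \<bar>deriv f x\<bar> \<le> K)"
proof (intro exI[of _ "max 1 \<bar>SOME D::real. False\<bar>"] conjI allI impI)
  fix f :: "real \<Rightarrow> real" and x
  assume f: "\<forall>x y. \<bar>f x - f y\<bar> \<le> \<bar>x - y\<bar>"
  show "\<bar>deriv f x\<bar> \<le> max 1 \<bar>SOME D::real. False\<bar>"
  proof (cases "\<exists>d. (f has_real_derivative d) (at x)")
    case True
    then obtain d where d: "(f has_real_derivative d) (at x)" by blast
    then have "((\<lambda>h. \<bar>(f (x + h) - f x) / h\<bar>) \<longlongrightarrow> \<bar>d\<bar>) (at 0)"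
      unfolding DERIV_def by (rule tendsto_rabs)
    moreover have "\<bar>(f (x + h) - f x) / h\<bar> \<le> 1" if "h \<noteq> 0" for h
      using f[rule_format, of "x + h" x] that by (simp add: divide_simps)
    ultimately have "\<bar>d\<bar> \<le> 1"
      by (intro tendsto_upperbound[of _ "\<bar>d\<bar>" "at 0" 1]) (auto simp: eventually_at_filter simp del: abs_divide)
    then show ?thesis using DERIV_imp_deriv[OF d] by simp
  next
    case False
    then show ?thesis by (simp add: deriv_def)
  qed
qed simp

lemma l1_lipschitz_partial_deriv_bound:
  "\<exists>K\<ge>0. \<forall>A. l1_lipschitz A \<longrightarrow> (\<forall>x y. \<bar>deriv (\<lambda>s. A s y) x\<bar> \<le> K)"
proof -
  obtain K where "K \<ge> 0" "\<And>f :: real \<Rightarrow> real. (\<forall>x y. \<bar>f x - f y\<bar> \<le> \<bar>x - y\<bar>) \<Longrightarrow> (\<forall>x. \<bar>deriv f x\<bar> \<le> K)"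
    using nonexpansive_deriv_bound by blast
  moreover have "\<bar>deriv (\<lambda>s. A s y) x\<bar> \<le> K" if "l1_lipschitz A" for A x y
    by (rule calculation(2)[rule_format]) (rule l1_lipschitz_section[OF that])
  ultimately show ?thesis by blast
qed

text \<open>
The contribution of the partial derivative in the first variable to the squared Sobolev norm.  The
contribution of the second variable is the energy of the transposed function.
\<close>
definition energy :: "(real \<Rightarrow> real \<Rightarrow> real) \<Rightarrow> real" where
  "energy A = (\<integral>y. (\<integral>x. (deriv (\<lambda>s. A s y) x)\<^sup>2 \<partial>unit_lborel) \<partial>unit_lborel)"

lemma interval_integral_unit_lborel:
  fixes f :: "real \<Rightarrow> real"
  assumes "f \<in> borel_measurable borel"
  shows "(LBINT x=0..1. f x) = (\<integral>x. f x \<partial>unit_lborel)"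
  using integral_unit_lborel[OF assms]
  by (simp add: interval_lebesgue_integral_def zero_ereal_def one_ereal_def)

interpretation unit_square: pair_sigma_finite unit_lborel unit_lborel
  by unfold_locales

lemma l1_lipschitz_line_energy_integrable:
  assumes A: "l1_lipschitz A"
  shows "integrable unit_lborel (\<lambda>y. \<integral>x. (deriv (\<lambda>s. A s y) x)\<^sup>2 \<partial>unit_lborel)" (is ?th1)
    and "integrable unit_lborel (\<lambda>x. (deriv (\<lambda>s. A s y) x)\<^sup>2)" (is ?th2)
    and "integrable (unit_lborel \<Otimes>\<^sub>M unit_lborel) (\<lambda>p. (deriv (\<lambda>s. A s (snd p)) (fst p))\<^sup>2)" (is ?th3)
proof -
  obtain K where K: "\<And>x y. \<bar>deriv (\<lambda>s. A s y) x\<bar> \<le> K"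
    using l1_lipschitz_partial_deriv_bound A by blast
  have bd: "norm ((deriv (\<lambda>s. A s y) x)\<^sup>2) \<le> K\<^sup>2" for x y
    using power_mono[OF K[of y x], of 2] by simp
  interpret sq: finite_measure "unit_lborel \<Otimes>\<^sub>M unit_lborel"
    by (intro finite_measure_pair_measure finite_measure_unit_lborel)
  have [measurable]: "(\<lambda>p. deriv (\<lambda>s. A s (snd p)) (fst p)) \<in> borel_measurable (unit_lborel \<Otimes>\<^sub>M unit_lborel)"
    using l1_lipschitz_partial_deriv_measurable[OF A] by (simp cong: measurable_cong_sets sets_pair_measure_cong)
  show th3: ?th3
    using bd by (intro sq.integrable_const_bound[where B="K\<^sup>2"]) auto
  then have "integrable (unit_lborel \<Otimes>\<^sub>M unit_lborel) (\<lambda>(x, y). (deriv (\<lambda>s. A s y) x)\<^sup>2)"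
    by (simp add: case_prod_unfold)
  from unit_square.integrable_snd[OF this] show ?th1 .
  have "(\<lambda>x. (\<lambda>p. deriv (\<lambda>s. A s (snd p)) (fst p)) (x, y)) \<in> borel_measurable unit_lborel" by measurable
  then show ?th2
    using bd by (intro unit_lborel.integrable_const_bound[where B="K\<^sup>2"]) auto
qed

text \<open>
The Sobolev norm integrates over \<open>x\<close> first in both terms; Fubini's theorem changes the order in the
second term.
\<close>
lemma sobolev_norm_eq_energy:
  assumes A: "l1_lipschitz A"
  shows "sobolev_norm A = sqrt (energy A + energy (\<lambda>x y. A y x))"
proof -
  let ?f = "\<lambda>x y. (deriv (\<lambda>s. A s y) x)\<^sup>2" and ?g = "\<lambda>x y. (deriv (\<lambda>t. A x t) y)\<^sup>2"
  let ?U = unit_lborel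
  note A' = l1_lipschitz_transpose[OF A]
  note f = l1_lipschitz_line_energy_integrable[OF A] and g = l1_lipschitz_line_energy_integrable[OF A']
  have gsq: "integrable (?U \<Otimes>\<^sub>M ?U) (\<lambda>(y, x). ?g x y)" using g(3) by (simp add: case_prod_unfold)
  have gsq': "integrable (?U \<Otimes>\<^sub>M ?U) (\<lambda>(x, y). ?g x y)"
    using unit_square.integrable_product_swap[OF gsq] by (simp add: case_prod_unfold)
  have gx: "(\<lambda>x. ?g x y) \<in> borel_measurable ?U" for y
    using measurable_compose[OF _ borel_measurable_integrable[OF gsq'], of "\<lambda>x. (x, y)" ?U] by simp
  have fx: "(\<lambda>x. ?f x y) \<in> borel_measurable ?U" for y using f(2) by (rule borel_measurable_integrable)
  have inner: "(LBINT x=0..1. ?f x y + ?g x y) = (\<integral>x. ?f x y + ?g x y \<partial>?U)" for y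
    using fx[of y] gx[of y] by (intro interval_integral_unit_lborel) (simp cong: measurable_cong_sets)
  have sum_int: "integrable (?U \<Otimes>\<^sub>M ?U) (\<lambda>(x, y). ?f x y + ?g x y)"
    using Bochner_Integration.integrable_add[OF f(3) gsq'] by (simp add: case_prod_unfold)
  have "(LBINT y=0..1. (LBINT x=0..1. ?f x y + ?g x y)) = (\<integral>y. (\<integral>x. ?f x y + ?g x y \<partial>?U) \<partial>?U)"
    unfolding inner
    using borel_measurable_integrable[OF unit_square.integrable_snd[OF sum_int]]
    by (intro interval_integral_unit_lborel) (simp cong: measurable_cong_sets)
  also have "\<dots> = (\<integral>p. ?f (fst p) (snd p) + ?g (fst p) (snd p) \<partial>(?U \<Otimes>\<^sub>M ?U))"
    using unit_square.integral_snd[OF sum_int] by (simp add: case_prod_unfold)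
  also have "\<dots> = (\<integral>p. ?f (fst p) (snd p) \<partial>(?U \<Otimes>\<^sub>M ?U)) + (\<integral>p. ?g (fst p) (snd p) \<partial>(?U \<Otimes>\<^sub>M ?U))"
    using f(3) gsq' by (simp add: case_prod_unfold)
  also have "(\<integral>p. ?f (fst p) (snd p) \<partial>(?U \<Otimes>\<^sub>M ?U)) = energy A"
    unfolding energy_def using unit_square.integral_snd[of ?f] f(3) by (simp add: case_prod_unfold)
  also have "(\<integral>p. ?g (fst p) (snd p) \<partial>(?U \<Otimes>\<^sub>M ?U)) = energy (\<lambda>x y. A y x)"
    unfolding energy_def using unit_square.integral_fst[OF gsq'] by (simp add: case_prod_unfold)
  finally show ?thesis by (simp add: sobolev_norm_def)
qed

lemma sobolev_norm_cong:
  assumes "\<And>x y. x \<in> {0<..<1} \<Longrightarrow> y \<in> {0<..<1} \<Longrightarrow> A x y = B x y"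
  shows "sobolev_norm A = sobolev_norm B"
proof -
  have ev: "\<forall>\<^sub>F s in nhds x. s \<in> {0<..<1}" if "x \<in> {0<..<1}" for x :: real
    using that by (intro eventually_nhds_in_open) auto
  have d1: "deriv (\<lambda>s. A s y) x = deriv (\<lambda>s. B s y) x" if "x \<in> {0<..<1}" "y \<in> {0<..<1}" for x y
    using that assms by (intro deriv_cong_ev refl eventually_mono[OF ev]) auto
  have d2: "deriv (\<lambda>t. A x t) y = deriv (\<lambda>t. B x t) y" if "x \<in> {0<..<1}" "y \<in> {0<..<1}" for x y
    using that assms by (intro deriv_cong_ev refl eventually_mono[OF ev]) auto
  show ?thesis unfolding sobolev_norm_def
    by (intro arg_cong[of _ _ sqrt] interval_integral_cong)
       (auto simp: d1 d2 zero_ereal_def one_ereal_def intro!: interval_integral_cong)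
qed

section \<open>Copulas extended to the plane\<close>

lemma copula_rectangle:
  assumes "copula C" "0 \<le> x" "x \<le> u" "u \<le> 1" "0 \<le> y" "y \<le> v" "v \<le> 1"
  shows "0 \<le> C u v - C u y - C x v + C x y"
proof -
  have "x \<in> {0..1}" "u \<in> {0..1}" "y \<in> {0..1}" "v \<in> {0..1}" using assms by simp_all
  with assms(1,3,6) show ?thesis unfolding copula_def by blast
qed

lemma copula_boundary:
  assumes "copula C" "0 \<le> x" "x \<le> 1"
  shows "C x 0 = 0" "C x 1 = x" "C 0 x = 0" "C 1 x = x"
proof -
  have "x \<in> {0..1}" using assms by simp
  with assms(1) show "C x 0 = 0" "C x 1 = x" "C 0 x = 0" "C 1 x = x" unfolding copula_def by blast+
qed

text \<open>
The two bounds come from the rectangles below and above the level \<open>v\<close>.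
\<close>
lemma copula_increment:
  assumes "copula C" "0 \<le> x" "x \<le> u" "u \<le> 1" "0 \<le> v" "v \<le> 1"
  shows "0 \<le> C u v - C x v" "C u v - C x v \<le> u - x"
proof -
  have b: "C x 0 = 0" "C u 0 = 0" "C x 1 = x" "C u 1 = u"
    using assms by (auto intro: copula_boundary)
  show "0 \<le> C u v - C x v" using copula_rectangle[OF assms(1-4), of 0 v] assms(5,6) b by simp
  show "C u v - C x v \<le> u - x" using copula_rectangle[OF assms(1-4), of v 1] assms(5,6) b by simp
qed

lemma copula_transpose:
  assumes "copula C" shows "copula (\<lambda>x y. C y x)"
proof -
  have "0 \<le> C v u - C y u - C v x + C y x"
    if "0 \<le> x" "x \<le> u" "u \<le> 1" "0 \<le> y" "y \<le> v" "v \<le> 1" for x u y v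
    using copula_rectangle[OF assms that(4-6,1-3)] by simp
  moreover have "\<forall>u\<in>{0..1}. \<forall>v\<in>{0..1}. C v u \<in> {0..1}" using assms unfolding copula_def by blast
  ultimately show ?thesis unfolding copula_def using copula_boundary[OF assms] by simp
qed

definition to_unit :: "real \<Rightarrow> real" where "to_unit x = max 0 (min 1 x)"

text \<open>
A copula is only meaningful on the unit square.  Clamping the arguments extends it to the plane
with sections of unit slope, and leaves all derivatives at interior points unchanged.
\<close>
definition copula_ext :: "(real \<Rightarrow> real \<Rightarrow> real) \<Rightarrow> real \<Rightarrow> real \<Rightarrow> real" where
  "copula_ext C x y = C (to_unit x) (to_unit y)"

lemma to_unit: "0 \<le> to_unit x" "to_unit x \<le> 1" "x \<in> {0..1} \<Longrightarrow> to_unit x = x"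
  by (auto simp: to_unit_def)

lemma to_unit_increment: "s \<le> t \<Longrightarrow> to_unit s \<le> to_unit t" "s \<le> t \<Longrightarrow> to_unit t - to_unit s \<le> t - s"
  unfolding to_unit_def by linarith+

lemma unit_slope_copula_ext:
  assumes "copula C" shows "unit_slope (\<lambda>s. copula_ext C s y)"
  unfolding unit_slope_def
proof (intro allI impI)
  fix s t :: real assume st: "s \<le> t"
  show "copula_ext C s y \<le> copula_ext C t y \<and> copula_ext C t y - copula_ext C s y \<le> t - s"
    using copula_increment[OF assms to_unit(1) to_unit_increment(1)[OF st] to_unit(2) to_unit(1,2), of y]
      to_unit_increment(2)[OF st]
    unfolding copula_ext_def by linarith
qed

lemma copula_ext_transpose: "copula_ext (\<lambda>x y. C y x) = (\<lambda>x y. copula_ext C y x)"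
  by (simp add: copula_ext_def fun_eq_iff)

lemma unit_slope_diff_abs:
  assumes "unit_slope f" "unit_slope g"
  shows "\<bar>(f x - g x) - (f x' - g x')\<bar> \<le> \<bar>x - x'\<bar>"
proof -
  have D: "f s \<le> f t" "f t - f s \<le> t - s" "g s \<le> g t" "g t - g s \<le> t - s" if "s \<le> t" for s t
    using assms that unfolding unit_slope_def by blast+
  show ?thesis
    by (cases "x \<le> x'") (use D[of x x'] D[of x' x] in linarith)+
qed

lemma l1_lipschitzI:
  assumes "\<And>x x' y. \<bar>A x y - A x' y\<bar> \<le> \<bar>x - x'\<bar>" "\<And>x y y'. \<bar>A x y - A x y'\<bar> \<le> \<bar>y - y'\<bar>"
  shows "l1_lipschitz A"
  unfolding l1_lipschitz_def
proof (intro allI)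
  fix x x' y y'
  show "\<bar>A x y - A x' y'\<bar> \<le> \<bar>x - x'\<bar> + \<bar>y - y'\<bar>"
    using assms(1)[of x y x'] assms(2)[of x' y y'] by linarith
qed

text \<open>
The constant 1 survives the difference because the increments of both copulas lie between 0 and the
increment of the argument.
\<close>
lemma l1_lipschitz_copula_diff:
  assumes C: "copula C" and D: "copula D"
  shows "l1_lipschitz (\<lambda>x y. copula_ext C x y - copula_ext D x y)"
proof -
  have 1: "\<bar>(copula_ext C x y - copula_ext D x y) - (copula_ext C x' y - copula_ext D x' y)\<bar> \<le> \<bar>x - x'\<bar>"
    if "copula C" "copula D" for C D x x' y
    by (rule unit_slope_diff_abs[OF unit_slope_copula_ext[OF that(1)] unit_slope_copula_ext[OF that(2)]])
  have 2: "\<bar>(copula_ext C x y - copula_ext D x y) - (copula_ext C x y' - copula_ext D x y')\<bar> \<le> \<bar>y - y'\<bar>" for x y y'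
    using 1[OF copula_transpose[OF C] copula_transpose[OF D], of y x y'] by (simp add: copula_ext_transpose[of C] copula_ext_transpose[of D])
  show ?thesis by (rule l1_lipschitzI[OF 1[OF C D] 2])
qed

lemma l1_lipschitz_copula_ext:
  assumes C: "copula C" shows "l1_lipschitz (copula_ext C)"
proof -
  have "\<bar>copula_ext C x y - copula_ext C x' y\<bar> \<le> \<bar>x - x'\<bar>" for x x' y
    by (rule unit_slope_abs[OF unit_slope_copula_ext[OF C]])
  moreover have "\<bar>copula_ext C x y - copula_ext C x y'\<bar> \<le> \<bar>y - y'\<bar>" for x y y'
    using unit_slope_abs[OF unit_slope_copula_ext[OF copula_transpose[OF C]], of y x y']
    by (simp add: copula_ext_transpose[of C])
  ultimately show ?thesis by (rule l1_lipschitzI)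
qed

section \<open>Copulas of maximal Sobolev norm\<close>

lemma integral_unit_lborel_ident: "integrable unit_lborel (\<lambda>x. x)" "(\<integral>x. x \<partial>unit_lborel) = 1 / 2"
proof -
  show "integrable unit_lborel (\<lambda>x. x)"
  proof (rule unit_lborel.integrable_const_bound[where B=1])
    show "AE x in unit_lborel. norm x \<le> 1" by (simp add: AE_unit_lborel_iff)
  qed simp
  have "(LBINT x=ereal 0..ereal 1. x) = 1\<^sup>2 / 2 - 0\<^sup>2 / (2::real)"
    by (intro interval_integral_FTC_finite)
       (auto intro!: continuous_intros derivative_eq_intros simp flip: has_real_derivative_iff_has_vector_derivative)
  then show "(\<integral>x. x \<partial>unit_lborel) = 1 / 2"
    by (subst interval_integral_unit_lborel[symmetric]) (auto simp: zero_ereal_def one_ereal_def)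
qed

lemma unit_slope_deriv_sq_le:
  assumes f: "unit_slope f"
  shows "(\<integral>x. (deriv f x)\<^sup>2 \<partial>unit_lborel) \<le> f 1 - f 0"
proof -
  have bd: "AE x in unit_lborel. 0 \<le> deriv f x \<and> deriv f x \<le> 1"
    using AE_unit_lborelI[OF unit_slope_deriv_bounds_AE[OF f]] by eventually_elim simp
  have "(\<integral>x. (deriv f x)\<^sup>2 \<partial>unit_lborel) \<le> (\<integral>x. deriv f x \<partial>unit_lborel)"
  proof (rule integral_mono_AE')
    show "integrable unit_lborel (deriv f)"
    proof (rule unit_lborel.integrable_const_bound[where B=1])
      show "AE x in unit_lborel. norm (deriv f x) \<le> 1" using bd by eventually_elim simp
    qed (use f in measurable)
    show "AE x in unit_lborel. (deriv f x)\<^sup>2 \<le> deriv f x"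
      using bd by eventually_elim (simp add: power2_eq_square mult_left_le)
    show "AE x in unit_lborel. 0 \<le> deriv f x" using bd by eventually_elim simp
  qed
  then show ?thesis by (simp add: integral_unit_lborel_deriv[OF f])
qed

lemma copula_line_energy_le:
  assumes C: "copula C" and y: "y \<in> {0..1}"
  shows "(\<integral>x. (deriv (\<lambda>s. copula_ext C s y) x)\<^sup>2 \<partial>unit_lborel) \<le> y"
  using unit_slope_deriv_sq_le[OF unit_slope_copula_ext[OF C, of y]] y copula_boundary[OF C, of y]
  by (simp add: copula_ext_def to_unit_def)

text \<open>
The deficit \<open>1/2 - energy\<close> is the integral over the lines of a nonnegative function, because the line
at height \<open>y\<close> has energy at most \<open>y\<close>.
\<close>
lemma copula_energy_deficit:
  assumes C: "copula C"
  shows "(\<integral>y. y - (\<integral>x. (deriv (\<lambda>s. copula_ext C s y) x)\<^sup>2 \<partial>unit_lborel) \<partial>unit_lborel) = 1 / 2 - energy (copula_ext C)"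
    and "AE y in unit_lborel. 0 \<le> y - (\<integral>x. (deriv (\<lambda>s. copula_ext C s y) x)\<^sup>2 \<partial>unit_lborel)"
  using l1_lipschitz_line_energy_integrable(1)[OF l1_lipschitz_copula_ext[OF C]] integral_unit_lborel_ident
  by (simp_all add: energy_def AE_unit_lborel_iff copula_line_energy_le[OF C])

lemma copula_energy_le: "copula C \<Longrightarrow> energy (copula_ext C) \<le> 1 / 2"
  using integral_nonneg_AE[OF copula_energy_deficit(2), of C] copula_energy_deficit(1)[of C] by simp

text \<open>
A nonnegative function with integral 0 vanishes almost everywhere.
\<close>
lemma extreme_copula_lines:
  assumes C: "copula C" and "energy (copula_ext C) = 1 / 2"
  shows "AE y in unit_lborel. (\<integral>x. (deriv (\<lambda>s. copula_ext C s y) x)\<^sup>2 \<partial>unit_lborel) = y"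
proof -
  have "integrable unit_lborel (\<lambda>y. y - (\<integral>x. (deriv (\<lambda>s. copula_ext C s y) x)\<^sup>2 \<partial>unit_lborel))"
    using l1_lipschitz_line_energy_integrable(1)[OF l1_lipschitz_copula_ext[OF C]] integral_unit_lborel_ident(1)
    by (rule Bochner_Integration.integrable_diff[rotated])
  from integral_nonneg_eq_0_iff_AE[OF this copula_energy_deficit(2)[OF C]]
  have "AE y in unit_lborel. y - (\<integral>x. (deriv (\<lambda>s. copula_ext C s y) x)\<^sup>2 \<partial>unit_lborel) = 0"
    using copula_energy_deficit(1)[OF C] assms(2) by simp
  then show ?thesis by eventually_elim simp
qed

lemma sobolev_norm_copula:
  assumes C: "copula C"
  shows "sobolev_norm C = sqrt (energy (copula_ext C) + energy (copula_ext (\<lambda>x y. C y x)))"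
proof -
  have "sobolev_norm C = sobolev_norm (copula_ext C)"
    by (rule sobolev_norm_cong) (simp add: copula_ext_def to_unit(3))
  then show ?thesis
    by (simp only: sobolev_norm_eq_energy[OF l1_lipschitz_copula_ext[OF C]] copula_ext_transpose[of C])
qed

text \<open>
Almost every line is extreme, so the energies of the differences converge to 0 line by line;
the uniform derivative bound dominates them.
\<close>
lemma energy_diff_limit:
  assumes C: "copula C" "energy (copula_ext C) = 1 / 2" and S: "\<And>n. copula (S n)"
    and lim: "\<And>x y. x \<in> {0..1} \<Longrightarrow> y \<in> {0..1} \<Longrightarrow> (\<lambda>n. S n x y) \<longlonglongrightarrow> C x y"
  shows "(\<lambda>n. energy (\<lambda>x y. copula_ext C x y - copula_ext (S n) x y)) \<longlonglongrightarrow> 0"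
proof -
  let ?D = "\<lambda>n x y. copula_ext C x y - copula_ext (S n) x y"
  note D = l1_lipschitz_copula_diff[OF C(1) S]
  obtain K where K: "\<And>n x y. \<bar>deriv (\<lambda>s. ?D n s y) x\<bar> \<le> K"
    using l1_lipschitz_partial_deriv_bound D by blast
  have ext_lim: "(\<lambda>n. copula_ext (S n) x y) \<longlonglongrightarrow> copula_ext C x y" for x y
    unfolding copula_ext_def by (rule lim) (simp_all add: to_unit)
  have "(\<lambda>n. energy (?D n)) \<longlonglongrightarrow> (\<integral>y. 0 \<partial>unit_lborel)"
    unfolding energy_def
  proof (rule integral_dominated_convergence[where w="\<lambda>_. \<integral>x. K\<^sup>2 \<partial>unit_lborel"])
    show "AE y in unit_lborel. (\<lambda>n. \<integral>x. (deriv (\<lambda>s. ?D n s y) x)\<^sup>2 \<partial>unit_lborel) \<longlonglongrightarrow> 0"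
    proof -
      have "AE y in unit_lborel. y \<in> {0<..<1}" by (simp add: AE_unit_lborel_iff)
      with extreme_copula_lines[OF C] show ?thesis
      proof eventually_elim
        case (elim y)
        have "copula_ext C 1 y - copula_ext C 0 y = y"
          using elim copula_boundary[OF C(1), of y] by (simp add: copula_ext_def to_unit_def)
        then show ?case
          using elim by (intro unit_slope_deriv_strong_limit unit_slope_copula_ext C S ext_lim) simp
      qed
    qed
    show "AE y in unit_lborel. norm (\<integral>x. (deriv (\<lambda>s. ?D n s y) x)\<^sup>2 \<partial>unit_lborel) \<le> (\<integral>x. K\<^sup>2 \<partial>unit_lborel)" for n
    proof (rule AE_I2)
      fix y
      have "(\<integral>x. (deriv (\<lambda>s. ?D n s y) x)\<^sup>2 \<partial>unit_lborel) \<le> (\<integral>x. K\<^sup>2 \<partial>unit_lborel)"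
      proof (rule integral_mono')
        show "(deriv (\<lambda>s. ?D n s y) x)\<^sup>2 \<le> K\<^sup>2" for x
          using power_mono[OF K[of y n x], of 2] by simp
      qed auto
      then show "norm (\<integral>x. (deriv (\<lambda>s. ?D n s y) x)\<^sup>2 \<partial>unit_lborel) \<le> (\<integral>x. K\<^sup>2 \<partial>unit_lborel)"
        by simp
    qed
  qed (use l1_lipschitz_line_energy_integrable(1)[OF D] in auto)
  then show ?thesis by simp
qed

text \<open>
The two energies of \<open>C\<close> are at most \<open>1/2\<close> each and add up to 1, so both are extreme and \<open>energy_diff_limit\<close> applies to \<open>C\<close> and to its transpose.
\<close>
lemma sobolev_limit_of_pointwise_limit:
  assumes C: "copula C" and norm1: "sobolev_norm C = 1" and S: "\<And>n. copula (S n)"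
    and lim: "\<And>x y. x \<in> {0..1} \<Longrightarrow> y \<in> {0..1} \<Longrightarrow> (\<lambda>n. S n x y) \<longlonglongrightarrow> C x y"
  shows "(\<lambda>n. sobolev_norm (\<lambda>x y. C x y - S n x y)) \<longlonglongrightarrow> 0"
proof -
  let ?D = "\<lambda>n x y. copula_ext C x y - copula_ext (S n) x y"
  note Ct = copula_transpose[OF C] and St = copula_transpose[OF S]
  have "energy (copula_ext C) + energy (copula_ext (\<lambda>x y. C y x)) = 1"
    using norm1 unfolding sobolev_norm_copula[OF C] by simp
  with copula_energy_le[OF C] copula_energy_le[OF Ct]
  have half: "energy (copula_ext C) = 1 / 2" "energy (copula_ext (\<lambda>x y. C y x)) = 1 / 2" by linarith+
  have "(\<lambda>n. energy (?D n)) \<longlonglongrightarrow> 0"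
    by (rule energy_diff_limit[OF C half(1) S lim])
  moreover have "(\<lambda>n. energy (\<lambda>x y. ?D n y x)) \<longlonglongrightarrow> 0"
    using energy_diff_limit[OF Ct half(2) St lim] unfolding copula_ext_def .
  ultimately have "(\<lambda>n. sqrt (energy (?D n) + energy (\<lambda>x y. ?D n y x))) \<longlonglongrightarrow> sqrt (0 + 0)"
    by (intro tendsto_real_sqrt tendsto_add)
  moreover have "sobolev_norm (\<lambda>x y. C x y - S n x y) = sqrt (energy (?D n) + energy (\<lambda>x y. ?D n y x))" for n
  proof -
    have "sobolev_norm (\<lambda>x y. C x y - S n x y) = sobolev_norm (?D n)"
      by (rule sobolev_norm_cong) (simp add: copula_ext_def to_unit(3))
    then show ?thesis by (simp only: sobolev_norm_eq_energy[OF l1_lipschitz_copula_diff[OF C S]])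
  qed
  ultimately show ?thesis by simp
qed

section \<open>Exchanging the cells of a grid\<close>

lemma finite_set_partition:
  fixes P :: "real set"
  assumes P: "finite P" "0 \<in> P" "1 \<in> P" "P \<subseteq> {0..1}"
  obtains n :: nat and a :: "nat \<Rightarrow> real" where "a 0 = 0" "a n = 1" "\<And>k. k < n \<Longrightarrow> a k < a (Suc k)"
    "\<And>k. k \<le> n \<Longrightarrow> a k \<in> P" "\<And>k p. k < n \<Longrightarrow> p \<in> P \<Longrightarrow> a k < p \<Longrightarrow> a (Suc k) \<le> p"
proof -
  define xs where "xs = sorted_list_of_set P"
  define n where "n = length xs - 1"
  have xs: "set xs = P" "sorted xs" "distinct xs" using P(1) by (simp_all add: xs_def)
  have ne: "xs \<noteq> []" using xs(1) P(2) by auto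
  have len: "length xs = Suc n" using ne by (simp add: n_def)
  have mem: "xs ! k \<in> P" if "k \<le> n" for k using that xs(1) len nth_mem[of k xs] by simp
  have strict: "xs ! j < xs ! k" if "j < k" "k \<le> n" for j k
    using that xs(2,3) len sorted_nth_mono[of xs j k] nth_eq_iff_index_eq[of xs j k] by fastforce
  have mono: "xs ! j \<le> xs ! k" if "j \<le> k" "k \<le> n" for j k
    using that xs(2) len sorted_nth_mono[of xs j k] by simp
  have idx: "\<exists>j\<le>n. p = xs ! j" if "p \<in> P" for p
    using that xs(1) len by (metis in_set_conv_nth less_Suc_eq_le)
  show thesis
  proof (rule that[of "\<lambda>k. xs ! k" n])
    obtain j where "j \<le> n" "0 = xs ! j" using idx[OF P(2)] by blast
    then show "xs ! 0 = 0" using mono[of 0 j] mem[of 0] P(4) by fastforce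
    obtain k where "k \<le> n" "1 = xs ! k" using idx[OF P(3)] by blast
    then show "xs ! n = 1" using mono[of k n] mem[of n] P(4) by fastforce
    show "xs ! k < xs ! Suc k" if "k < n" for k using strict that by simp
    show "xs ! k \<in> P" if "k \<le> n" for k using mem that by simp
    show "xs ! Suc k \<le> p" if k: "k < n" and p: "p \<in> P" "xs ! k < p" for k p
    proof -
      obtain j where j: "j \<le> n" "p = xs ! j" using idx[OF p(1)] by blast
      have "k < j"
      proof (rule ccontr)
        assume "\<not> k < j"
        then have "xs ! j \<le> xs ! k" using mono k by simp
        then show False using p(2) j(2) by simp
      qed
      then show ?thesis using mono[of "Suc k" j] j by simp
    qed
  qed
qed

lemma chain_locate:
  fixes a :: "nat \<Rightarrow> real"
  assumes "a 0 \<le> x" "x < a n"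
  shows "\<exists>j<n. x \<in> {a j..<a (Suc j)}"
  using assms
proof (induction n)
  case (Suc n)
  then show ?case by (cases "x < a n") (auto simp: less_Suc_eq)
qed simp

text \<open>
The left end of the \<open>j\<close>-th interval in the \<open>i\<close>-th strip: the lengths of the preceding intervals are
the masses of the cells \<open>(i, 0)\<close> to \<open>(i, j - 1)\<close>, and their sum telescopes to the given difference.
\<close>
definition cut :: "(real \<Rightarrow> real \<Rightarrow> real) \<Rightarrow> nat \<Rightarrow> nat \<Rightarrow> nat \<Rightarrow> real" where
  "cut C N i j = real i / N + C (real (Suc i) / N) (real j / N) - C (real i / N) (real j / N)"

text \<open>
Half-open, so that the intervals tile \<open>{0..<1}\<close> exactly and an interval of a cell without mass is
empty.
\<close>
definition cell :: "(real \<Rightarrow> real \<Rightarrow> real) \<Rightarrow> nat \<Rightarrow> nat \<Rightarrow> nat \<Rightarrow> real set" where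
  "cell C N i j = {cut C N i j..<cut C N i (Suc j)}"

text \<open>
Each interval is translated to the position that the same cell has when the second axis is cut, that
is, when the construction is carried out for the transposed copula.  Writing the map as a sum of
displacements makes it Borel by construction and the identity outside \<open>{0..<1}\<close>.
\<close>
definition cell_exchange :: "(real \<Rightarrow> real \<Rightarrow> real) \<Rightarrow> nat \<Rightarrow> real \<Rightarrow> real" where
  "cell_exchange C N x = x + (\<Sum>(i, j)\<in>{..<N} \<times> {..<N}.
     indicator (cell C N i j) x * (cut (\<lambda>x y. C y x) N j i - cut C N i j))"

lemma cut_ends:
  assumes "copula C" "i < N"
  shows "cut C N i 0 = real i / N" "cut C N i N = real (Suc i) / N"
  using assms copula_boundary[OF assms(1), of "real i / N"] copula_boundary[OF assms(1), of "real (Suc i) / N"]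
  by (simp_all add: cut_def)

lemma cut_Suc_diff:
  "cut C N i (Suc j) - cut C N i j = C (real (Suc i) / N) (real (Suc j) / N) - C (real (Suc i) / N) (real j / N)
     - C (real i / N) (real (Suc j) / N) + C (real i / N) (real j / N)"
  by (simp add: cut_def)

text \<open>
A cell has the same mass in both directions, so a translation maps its one interval onto the other.
\<close>
lemma cut_Suc_diff_transpose:
  "cut (\<lambda>x y. C y x) N j (Suc i) - cut (\<lambda>x y. C y x) N j i = cut C N i (Suc j) - cut C N i j"
  by (simp add: cut_Suc_diff)

lemma cut_mono:
  assumes C: "copula C" and "i < N" "j \<le> k" "k \<le> N"
  shows "cut C N i j \<le> cut C N i k"
  using assms(3,4)
proof (induction k rule: dec_induct)
  case (step k)
  have "0 \<le> C (real (Suc i) / N) (real (Suc k) / N) - C (real (Suc i) / N) (real k / N)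
     - C (real i / N) (real (Suc k) / N) + C (real i / N) (real k / N)"
    using assms(2) step by (intro copula_rectangle[OF C]) (auto simp: divide_simps)
  then show ?case using step cut_Suc_diff[of C N i k] by simp
qed simp

lemma cell_subset_strip:
  assumes C: "copula C" and "i < N" "j < N"
  shows "cell C N i j \<subseteq> {real i / N..<real (Suc i) / N}"
  using cut_mono[OF C assms(2), of 0 j] cut_mono[OF C assms(2), of "Suc j" N] assms(3) cut_ends[OF C assms(2)]
  by (auto simp: cell_def)

lemma same_strip:
  fixes x :: real and N :: nat
  assumes "x \<in> {real i / N..<real (Suc i) / N}" "x \<in> {real k / N..<real (Suc k) / N}"
  shows "i = k"
proof -
  have N: "real N > 0" using assms(1) by (intro of_nat_0_less_iff[THEN iffD2] Nat.gr0I) simp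
  have "real i \<le> x * N" "x * N < real (Suc i)" "real k \<le> x * N" "x * N < real (Suc k)"
    using assms unfolding atLeastLessThan_iff pos_divide_le_eq[OF N] pos_less_divide_eq[OF N] by blast+
  then show ?thesis by linarith
qed

lemma cell_unique:
  assumes C: "copula C" and ij: "i < N" "j < N" "x \<in> cell C N i j" and kl: "k < N" "l < N" "x \<in> cell C N k l"
  shows "i = k" "j = l"
proof -
  show ik: "i = k"
    using cell_subset_strip[OF C ij(1,2)] cell_subset_strip[OF C kl(1,2)] ij(3) kl(3) by (intro same_strip[of x i N k]) auto
  have *: "\<not> j < l" if "x \<in> cell C N i j" "x \<in> cell C N i l" "l < N" for j l
  proof
    assume "j < l"
    then have "cut C N i (Suc j) \<le> cut C N i l" using cut_mono[OF C ij(1)] that(3) by simp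
    then show False using that(1,2) by (simp add: cell_def)
  qed
  show "j = l" using *[of j l] *[of l j] ij kl ik by force
qed

lemma cell_exists:
  assumes C: "copula C" and N: "N > 0" and x: "x \<in> {0..<1}"
  obtains i j where "i < N" "j < N" "x \<in> cell C N i j"
proof -
  obtain i where i: "i < N" "x \<in> {real i / N..<real (Suc i) / N}"
    using chain_locate[of "\<lambda>i. real i / N" x N] x N by auto
  then obtain j where "j < N" "x \<in> {cut C N i j..<cut C N i (Suc j)}"
    using chain_locate[of "cut C N i" x N] cut_ends[OF C i(1)] by auto
  with i that show thesis by (auto simp: cell_def)
qed

lemma cell_subset_unit:
  assumes C: "copula C" and "i < N" "j < N"
  shows "cell C N i j \<subseteq> {0..<1}"
proof -
  have "{real i / N..<real (Suc i) / N} \<subseteq> {0..<1}"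
  proof
    fix x assume x: "x \<in> {real i / N..<real (Suc i) / N}"
    have "0 \<le> real i / N" "real (Suc i) / N \<le> 1" using assms(2) by (simp_all add: divide_simps)
    with x show "x \<in> {0..<1}" unfolding atLeastLessThan_iff by linarith
  qed
  then show ?thesis using cell_subset_strip[OF assms] by blast
qed

lemma unit_interval_eq_cells:
  assumes C: "copula C" and N: "N > 0"
  shows "{0..<1} = (\<Union>(i, j)\<in>{..<N} \<times> {..<N}. cell C N i j)"
proof
  show "{0..<1} \<subseteq> (\<Union>(i, j)\<in>{..<N} \<times> {..<N}. cell C N i j)"
  proof
    fix x :: real assume "x \<in> {0..<1}"
    then obtain i j where "i < N" "j < N" "x \<in> cell C N i j" by (rule cell_exists[OF C N])
    then show "x \<in> (\<Union>(i, j)\<in>{..<N} \<times> {..<N}. cell C N i j)" by blast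
  qed
  show "(\<Union>(i, j)\<in>{..<N} \<times> {..<N}. cell C N i j) \<subseteq> {0..<1}"
    using cell_subset_unit[OF C] by blast
qed

lemma cell_exchange_on_cell:
  assumes C: "copula C" and ij: "i < N" "j < N" "x \<in> cell C N i j"
  shows "cell_exchange C N x = x + (cut (\<lambda>x y. C y x) N j i - cut C N i j)"
proof -
  have "(\<Sum>(k, l)\<in>{..<N} \<times> {..<N}. indicator (cell C N k l) x * (cut (\<lambda>x y. C y x) N l k - cut C N k l))
      = (\<Sum>p\<in>{(i, j)}. indicator (cell C N (fst p) (snd p)) x * (cut (\<lambda>x y. C y x) N (snd p) (fst p) - cut C N (fst p) (snd p)))"
    unfolding case_prod_unfold
  proof (rule sum.mono_neutral_right)
    show "\<forall>p\<in>{..<N} \<times> {..<N} - {(i, j)}. indicator (cell C N (fst p) (snd p)) x * (cut (\<lambda>x y. C y x) N (snd p) (fst p) - cut C N (fst p) (snd p)) = 0"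
    proof
      fix p assume p: "p \<in> {..<N} \<times> {..<N} - {(i, j)}"
      then have "x \<notin> cell C N (fst p) (snd p)"
        using cell_unique[OF C ij, of "fst p" "snd p"] by force
      then show "indicator (cell C N (fst p) (snd p)) x * (cut (\<lambda>x y. C y x) N (snd p) (fst p) - cut C N (fst p) (snd p)) = 0"
        by simp
    qed
  qed (use ij in auto)
  then show ?thesis using ij by (simp add: cell_exchange_def)
qed

lemma cell_exchange_outside:
  assumes "copula C" "x \<notin> {0..<1}"
  shows "cell_exchange C N x = x"
proof -
  have "indicator (cell C N i j) x = (0::real)" if "i < N" "j < N" for i j
    using cell_subset_unit[OF assms(1) that] assms(2) by (auto simp: indicator_def)
  then show ?thesis by (auto simp: cell_exchange_def intro!: sum.neutral)
qed

lemma cell_exchange_in_cell: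
  assumes C: "copula C" and ij: "i < N" "j < N" "x \<in> cell C N i j"
  shows "cell_exchange C N x \<in> cell (\<lambda>x y. C y x) N j i"
  using ij(3) cut_Suc_diff_transpose[of C N j i] unfolding cell_exchange_on_cell[OF assms] cell_def by auto

text \<open>
The exchange for the transposed copula undoes every translation.
\<close>
lemma cell_exchange_inverse:
  assumes C: "copula C" and N: "N > 0"
  shows "cell_exchange (\<lambda>x y. C y x) N (cell_exchange C N x) = x"
proof (cases "x \<in> {0..<1}")
  case True
  then obtain i j where ij: "i < N" "j < N" "x \<in> cell C N i j" by (rule cell_exists[OF C N])
  show ?thesis
    using cell_exchange_on_cell[OF copula_transpose[OF C] ij(2,1) cell_exchange_in_cell[OF C ij]]
      cell_exchange_on_cell[OF C ij] by simp
next
  case False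
  then show ?thesis by (simp add: cell_exchange_outside C copula_transpose)
qed

lemma cell_exchange_unit:
  assumes C: "copula C" and N: "N > 0" and x: "x \<in> {0..<1}"
  shows "cell_exchange C N x \<in> {0..<1}"
proof -
  from x obtain i j where ij: "i < N" "j < N" "x \<in> cell C N i j" by (rule cell_exists[OF C N])
  show ?thesis
    using cell_exchange_in_cell[OF C ij] cell_subset_unit[OF copula_transpose[OF C] ij(2,1)] by blast
qed

lemma bij_betw_cell_exchange:
  assumes C: "copula C" and N: "N > 0"
  shows "bij_betw (cell_exchange C N) {0..1} {0..1}"
proof (rule bij_betw_byWitness[where f'="cell_exchange (\<lambda>x y. C y x) N"])
  have unit: "cell_exchange D N ` {0..1} \<subseteq> {0..1}" if D: "copula D" for D
  proof
    fix y assume "y \<in> cell_exchange D N ` {0..1}"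
    then obtain x where x: "x \<in> {0..1}" "y = cell_exchange D N x" by blast
    show "y \<in> {0..1}"
      using cell_exchange_unit[OF D N, of x] cell_exchange_outside[OF D, of x N] x by (cases "x = 1") auto
  qed
  show "cell_exchange C N ` {0..1} \<subseteq> {0..1}" by (rule unit[OF C])
  show "cell_exchange (\<lambda>x y. C y x) N ` {0..1} \<subseteq> {0..1}" by (rule unit[OF copula_transpose[OF C]])
  show "\<forall>x\<in>{0..1}. cell_exchange (\<lambda>x y. C y x) N (cell_exchange C N x) = x"
    using cell_exchange_inverse[OF C N] by blast
  show "\<forall>x\<in>{0..1}. cell_exchange C N (cell_exchange (\<lambda>x y. C y x) N x) = x"
    using cell_exchange_inverse[OF copula_transpose[OF C] N] by simp
qed

text \<open>
A partition into nondegenerate intervals is obtained from the set of all cut points.  No cut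
point lies between two consecutive ones, so each such interval is contained in a single cell.
\<close>
lemma piecewise_unit_affine_cell_exchange:
  assumes C: "copula C" and N: "N > 0"
  shows "piecewise_unit_affine (cell_exchange C N)"
proof -
  define P where "P = (\<lambda>(i, j). cut C N i j) ` ({..<N} \<times> {..N})"
  have cutP: "cut C N i j \<in> P" if "i < N" "j \<le> N" for i j
    using that unfolding P_def by (intro image_eqI[of _ _ "(i, j)"]) auto
  have "finite P" by (simp add: P_def)
  moreover have "0 \<in> P" using cutP[of 0 0] cut_ends(1)[OF C N] N by simp
  moreover have "1 \<in> P" using cutP[of "N - 1" N] cut_ends(2)[OF C, of "N - 1" N] N by simp
  moreover have "P \<subseteq> {0..1}"
  proof
    fix p assume "p \<in> P"
    then obtain i j where ij: "i < N" "j \<le> N" "p = cut C N i j" by (auto simp: P_def)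
    have "real i / N \<le> p" "p \<le> real (Suc i) / N"
      using cut_mono[OF C ij(1), of 0 j] cut_mono[OF C ij(1), of j N] ij cut_ends[OF C ij(1)] by auto
    moreover have "0 \<le> real i / N" "real (Suc i) / N \<le> 1" using ij(1) by (simp_all add: divide_simps)
    ultimately show "p \<in> {0..1}" unfolding atLeastAtMost_iff by linarith
  qed
  ultimately obtain n a where a: "a 0 = 0" "a n = 1" "\<And>k. k < n \<Longrightarrow> a k < a (Suc k)"
    "\<And>k. k \<le> n \<Longrightarrow> a k \<in> P" "\<And>k p. k < n \<Longrightarrow> p \<in> P \<Longrightarrow> a k < p \<Longrightarrow> a (Suc k) \<le> p"
    by (rule finite_set_partition) blast
  have "\<exists>s\<in>{1, -1}. \<exists>b. \<forall>x\<in>{a k<..<a (Suc k)}. cell_exchange C N x = s * x + b" if k: "k < n" for k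
  proof -
    have "a k \<in> {0..1}" "a (Suc k) \<in> {0..1}"
      using a(4)[of k] a(4)[of "Suc k"] k \<open>P \<subseteq> {0..1}\<close> by auto
    then have "a k \<in> {0..<1}" using a(3)[OF k] unfolding atLeastAtMost_iff atLeastLessThan_iff by linarith
    then obtain i j where ij: "i < N" "j < N" "a k \<in> cell C N i j" by (rule cell_exists[OF C N])
    then have "a (Suc k) \<le> cut C N i (Suc j)" by (intro a(5)[OF k] cutP) (auto simp: cell_def)
    then have "x \<in> cell C N i j" if "x \<in> {a k<..<a (Suc k)}" for x
      using that ij(3) by (auto simp: cell_def)
    then have "\<forall>x\<in>{a k<..<a (Suc k)}. cell_exchange C N x = 1 * x + (cut (\<lambda>x y. C y x) N j i - cut C N i j)"
      using cell_exchange_on_cell[OF C ij(1,2)] by simp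
    then show ?thesis by blast
  qed
  with a(1,2,3) show ?thesis unfolding piecewise_unit_affine_def by blast
qed

section \<open>The cell exchange preserves Lebesgue measure\<close>

lemma cell_exchange_measurable [measurable]: "cell_exchange C N \<in> borel_measurable borel"
proof -
  have [measurable]: "cell C N i j \<in> sets borel" for i j by (simp add: cell_def)
  show ?thesis unfolding cell_exchange_def[abs_def] case_prod_unfold by measurable
qed

lemma emeasure_lborel_shift:
  fixes d :: real
  assumes [measurable]: "A \<in> sets borel"
  shows "emeasure lborel {x. x + d \<in> A} = emeasure lborel A"
proof -
  have "emeasure lborel A = emeasure (distr lborel borel ((+) d)) A"
    using lborel_distr_plus[of d] by simp
  also have "\<dots> = emeasure lborel {x. x + d \<in> A}"
    by (subst emeasure_distr) (auto simp: vimage_def add.commute)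
  finally show ?thesis by simp
qed

lemma emeasure_unit_eq_sum_cells:
  assumes C: "copula C" and N: "N > 0" and A [measurable]: "A \<in> sets borel"
  shows "emeasure lborel ({0..<1} \<inter> A) = (\<Sum>(i, j)\<in>{..<N} \<times> {..<N}. emeasure lborel (cell C N i j \<inter> A))"
proof -
  have "{0..<1} \<inter> A = (\<Union>p\<in>{..<N} \<times> {..<N}. cell C N (fst p) (snd p) \<inter> A)"
    unfolding unit_interval_eq_cells[OF C N] by auto
  moreover have "emeasure lborel (\<Union>p\<in>{..<N} \<times> {..<N}. cell C N (fst p) (snd p) \<inter> A)
     = (\<Sum>p\<in>{..<N} \<times> {..<N}. emeasure lborel (cell C N (fst p) (snd p) \<inter> A))"
  proof (rule sum_emeasure[symmetric])
    show "(\<lambda>p. cell C N (fst p) (snd p) \<inter> A) ` ({..<N} \<times> {..<N}) \<subseteq> sets lborel"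
      by (auto simp: cell_def)
    show "disjoint_family_on (\<lambda>p. cell C N (fst p) (snd p) \<inter> A) ({..<N} \<times> {..<N})"
      unfolding disjoint_family_on_def
    proof (intro ballI impI)
      fix p q assume pq: "p \<in> {..<N} \<times> {..<N}" "q \<in> {..<N} \<times> {..<N}" "p \<noteq> q"
      have False if "x \<in> cell C N (fst p) (snd p)" "x \<in> cell C N (fst q) (snd q)" for x
        using cell_unique[OF C _ _ that(1) _ _ that(2)] pq by (auto simp: prod_eq_iff)
      then show "(cell C N (fst p) (snd p) \<inter> A) \<inter> (cell C N (fst q) (snd q) \<inter> A) = {}" by blast
    qed
  qed simp
  ultimately show ?thesis by (simp add: case_prod_unfold)
qed

text \<open>
On each cell the exchange is a translation onto the corresponding cell of the transposed copula.
\<close>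
lemma emeasure_cell_exchange_vimage:
  assumes C: "copula C" and N: "N > 0" and A [measurable]: "A \<in> sets borel"
  shows "emeasure lborel ({0..<1} \<inter> cell_exchange C N -` A) = emeasure lborel ({0..<1} \<inter> A)"
proof -
  let ?f = "cell_exchange C N" and ?Ct = "\<lambda>x y. C y x"
  have "?f -` A \<in> sets borel" using measurable_sets_borel[OF cell_exchange_measurable A] by simp
  then have "emeasure lborel ({0..<1} \<inter> ?f -` A)
     = (\<Sum>(i, j)\<in>{..<N} \<times> {..<N}. emeasure lborel (cell C N i j \<inter> ?f -` A))"
    by (rule emeasure_unit_eq_sum_cells[OF C N])
  also have "\<dots> = (\<Sum>(i, j)\<in>{..<N} \<times> {..<N}. emeasure lborel (cell ?Ct N j i \<inter> A))"
  proof (rule sum.cong[OF refl], clarsimp)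
    fix i j assume ij: "i < N" "j < N"
    define d where "d = cut ?Ct N j i - cut C N i j"
    have "x \<in> cell C N i j \<longleftrightarrow> x + d \<in> cell ?Ct N j i" for x
      using cut_Suc_diff_transpose[of C N j i] unfolding cell_def d_def by auto
    moreover have "?f x = x + d" if "x \<in> cell C N i j" for x
      using cell_exchange_on_cell[OF C ij that] by (simp add: d_def)
    ultimately have "cell C N i j \<inter> ?f -` A = {x. x + d \<in> cell ?Ct N j i \<inter> A}" by auto
    then show "emeasure lborel (cell C N i j \<inter> ?f -` A) = emeasure lborel (cell ?Ct N j i \<inter> A)"
      by (simp only:) (rule emeasure_lborel_shift, simp add: cell_def)
  qed
  also have "\<dots> = (\<Sum>(j, i)\<in>{..<N} \<times> {..<N}. emeasure lborel (cell ?Ct N j i \<inter> A))"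
    unfolding sum.cartesian_product[symmetric] by (rule sum.swap)
  also have "\<dots> = emeasure lborel ({0..<1} \<inter> A)"
    by (rule emeasure_unit_eq_sum_cells[OF copula_transpose[OF C] N A, symmetric])
  finally show ?thesis .
qed

lemma emeasure_Icc_eq_Ico:
  assumes [measurable]: "A \<in> sets borel"
  shows "emeasure lborel ({0..1::real} \<inter> A) = emeasure lborel ({0..<1} \<inter> A)"
proof (rule emeasure_eq_AE)
  show "AE x in lborel. x \<in> {0..1} \<inter> A \<longleftrightarrow> x \<in> {0..<1} \<inter> A"
    using AE_lborel_singleton[of 1] by eventually_elim auto
qed auto

lemma lebesgue_preservingI:
  assumes [measurable]: "f \<in> borel_measurable borel" and f: "\<And>x. x \<in> {0..1} \<Longrightarrow> f x \<in> {0..1}"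
    and em: "\<And>A. A \<in> sets borel \<Longrightarrow> emeasure lborel ({0..1} \<inter> f -` A) = emeasure lborel ({0..1} \<inter> A)"
  shows "lebesgue_preserving f"
proof -
  let ?U = "restrict_space lborel {0..1::real}"
  have meas: "f \<in> ?U \<rightarrow>\<^sub>M ?U"
    using f by (intro measurable_restrict_space3) auto
  have "distr ?U ?U f = ?U"
  proof (rule measure_eqI)
    fix A assume "A \<in> sets (distr ?U ?U f)"
    then have A: "A \<in> sets borel" "A \<subseteq> {0..1}" by (auto simp: sets_restrict_space_iff)
    have "emeasure (distr ?U ?U f) A = emeasure ?U (f -` A \<inter> space ?U)"
      using meas A by (intro emeasure_distr) (auto simp: sets_restrict_space_iff)
    also have "\<dots> = emeasure lborel ({0..1} \<inter> f -` A)"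
      by (subst emeasure_restrict_space) (auto simp: space_restrict_space Int_commute)
    also have "\<dots> = emeasure lborel A" using em[OF A(1)] A(2) by (simp add: Int_absorb1)
    also have "\<dots> = emeasure ?U A" using A by (subst emeasure_restrict_space) auto
    finally show "emeasure (distr ?U ?U f) A = emeasure ?U A" .
  qed simp
  with meas show ?thesis by (simp add: lebesgue_preserving_def)
qed

lemma emeasure_cell_exchange_vimage_Icc:
  assumes "copula C" "N > 0" "A \<in> sets borel"
  shows "emeasure lborel ({0..1} \<inter> cell_exchange C N -` A) = emeasure lborel ({0..1} \<inter> A)"
  using emeasure_cell_exchange_vimage[OF assms] measurable_sets_borel[OF cell_exchange_measurable assms(3)] assms(3)
  by (simp add: emeasure_Icc_eq_Ico)

section \<open>The copula of a rearrangement of the unit interval\<close>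

text \<open>
The distribution function of the image of Lebesgue measure under \<open>\<lambda>t. (t, f t)\<close>.
\<close>
definition graph_copula :: "(real \<Rightarrow> real) \<Rightarrow> real \<Rightarrow> real \<Rightarrow> real" where
  "graph_copula f u v = measure lborel {t \<in> {0..u}. f t \<le> v}"

locale unit_rearrangement =
  fixes f :: "real \<Rightarrow> real"
  assumes borel [measurable]: "f \<in> borel_measurable borel"
    and bij: "bij_betw f {0..1} {0..1}"
    and preserving: "\<And>A. A \<in> sets borel \<Longrightarrow> emeasure lborel ({0..1} \<inter> f -` A) = emeasure lborel ({0..1} \<inter> A)"
begin

lemma in_unit: "t \<in> {0..1} \<Longrightarrow> f t \<in> {0..1}"
  using bij bij_betwE by blast

text \<open>
Injectivity makes the preimage of a horizontal line negligible, so closed and half-open rectangles have equal mass.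
\<close>
lemma AE_value_neq: "AE t in lborel. t \<in> {0..1} \<longrightarrow> f t \<noteq> y"
proof -
  have "finite {t \<in> {0..1}. f t = y}"
  proof (rule finite_subset)
    show "{t \<in> {0..1}. f t = y} \<subseteq> {inv_into {0..1} f y}"
      using bij_betw_imp_inj_on[OF bij] by (auto simp: inv_into_f_f)
  qed simp
  then have "AE t in lborel. t \<notin> {t \<in> {0..1}. f t = y}"
    by (intro AE_not_in finite_imp_null_set_lborel)
  then show ?thesis by eventually_elim simp
qed

lemma fmeasurable_bounded:
  fixes a b :: real
  assumes [measurable]: "Measurable.pred borel P"
  shows "{t \<in> {a..b}. P t} \<in> fmeasurable lborel"
proof (rule fmeasurableI2[OF fmeasurable_cbox[of a b]])
  show "{t \<in> {a..b}. P t} \<subseteq> cbox a b" by (auto simp only: cbox_interval)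
  have "{a..b} \<inter> {t \<in> space borel. P t} \<in> sets borel"
    by (rule sets.Int[OF _ predE[OF assms]]) simp
  moreover have "{a..b} \<inter> {t \<in> space borel. P t} = {t \<in> {a..b}. P t}" by (simp add: Int_def)
  ultimately show "{t \<in> {a..b}. P t} \<in> sets lborel" by (simp only: sets_lborel)
qed

lemma graph_copula_bounds: "0 \<le> u \<Longrightarrow> 0 \<le> graph_copula f u v \<and> graph_copula f u v \<le> u"
proof -
  assume u: "0 \<le> u"
  have "{t \<in> {0..u}. f t \<le> v} \<in> sets lborel"
    by (rule fmeasurableD[OF fmeasurable_bounded]) simp
  then have "measure lborel {t \<in> {0..u}. f t \<le> v} \<le> measure lborel {0..u}"
    using fmeasurable_cbox[of 0 u] by (intro measure_mono_fmeasurable) auto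
  then show ?thesis using u by (simp add: graph_copula_def)
qed

lemma rectangle_volume:
  assumes "0 \<le> x" "x \<le> u" "u \<le> 1" "y \<le> v"
  shows "graph_copula f u v - graph_copula f u y - graph_copula f x v + graph_copula f x y
     = measure lborel {t \<in> {x..u}. f t \<in> {y..v}}"
proof -
  have strip: "graph_copula f w v - graph_copula f w y = measure lborel {t \<in> {0..w}. y < f t \<and> f t \<le> v}" for w
  proof -
    have "measure lborel ({t \<in> {0..w}. f t \<le> v} - {t \<in> {0..w}. f t \<le> y})
       = graph_copula f w v - graph_copula f w y"
      unfolding graph_copula_def using assms(4) by (intro measurable_measure_Diff fmeasurable_bounded) auto
    moreover have "{t \<in> {0..w}. f t \<le> v} - {t \<in> {0..w}. f t \<le> y} = {t \<in> {0..w}. y < f t \<and> f t \<le> v}" by auto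
    ultimately show ?thesis by simp
  qed
  have "measure lborel ({t \<in> {0..u}. y < f t \<and> f t \<le> v} - {t \<in> {0..x}. y < f t \<and> f t \<le> v})
     = measure lborel {t \<in> {0..u}. y < f t \<and> f t \<le> v} - measure lborel {t \<in> {0..x}. y < f t \<and> f t \<le> v}"
    using assms(2) by (intro measurable_measure_Diff fmeasurable_bounded) auto
  also have "\<dots> = graph_copula f u v - graph_copula f u y - graph_copula f x v + graph_copula f x y"
    using strip[of u] strip[of x] by simp
  finally have "graph_copula f u v - graph_copula f u y - graph_copula f x v + graph_copula f x y
     = measure lborel ({t \<in> {0..u}. y < f t \<and> f t \<le> v} - {t \<in> {0..x}. y < f t \<and> f t \<le> v})" by simp
  also have "\<dots> = measure lborel {t \<in> {x..u}. f t \<in> {y..v}}"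
  proof (rule measure_eq_AE)
    show "AE t in lborel. t \<in> {t \<in> {0..u}. y < f t \<and> f t \<le> v} - {t \<in> {0..x}. y < f t \<and> f t \<le> v}
        \<longleftrightarrow> t \<in> {t \<in> {x..u}. f t \<in> {y..v}}"
      using AE_value_neq[of y] AE_lborel_singleton[of x]
      by eventually_elim (use assms in auto)
  qed measurable
  finally show ?thesis .
qed

lemma copula: "copula (graph_copula f)"
proof -
  have left: "graph_copula f u v = u" if "0 \<le> u" "u \<le> 1" "1 \<le> v" for u v
  proof -
    have "{t \<in> {0..u}. f t \<le> v} = {0..u}" using in_unit that by fastforce
    then show ?thesis using that by (simp add: graph_copula_def)
  qed
  have bot: "graph_copula f u 0 = 0" if "0 \<le> u" "u \<le> 1" for u
  proof -
    have "measure lborel {t \<in> {0..u}. f t \<le> 0} = measure lborel ({} :: real set)"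
    proof (rule measure_eq_AE)
      show "AE t in lborel. t \<in> {t \<in> {0..u}. f t \<le> 0} \<longleftrightarrow> t \<in> {}"
        using AE_value_neq[of 0] by eventually_elim (use in_unit that in force)
    qed auto
    then show ?thesis by (simp add: graph_copula_def)
  qed
  have zero: "graph_copula f 0 v = 0" for v using graph_copula_bounds[of 0 v] by simp
  have right: "graph_copula f 1 v = v" if "0 \<le> v" "v \<le> 1" for v
  proof -
    have "emeasure lborel {t \<in> {0..1}. f t \<le> v} = emeasure lborel ({0..1} \<inter> {..v})"
      using preserving[of "{..v}"] by (simp add: Int_def vimage_def)
    also have "{0..1} \<inter> {..v} = {0..v}" using that by auto
    finally show ?thesis using that by (simp add: graph_copula_def measure_def)
  qed
  have mono: "graph_copula f u v \<in> {0..1}" if "0 \<le> u" "u \<le> 1" for u v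
    using graph_copula_bounds[OF that(1), of v] that(2) by simp
  have rect: "0 \<le> graph_copula f u v - graph_copula f u y - graph_copula f x v + graph_copula f x y"
    if "0 \<le> x" "x \<le> u" "u \<le> 1" "y \<le> v" for x u y v
    unfolding rectangle_volume[OF that] by simp
  show ?thesis unfolding copula_def
    using left bot zero right mono rect by simp
qed

lemma shuffle_of_min:
  assumes aff: "piecewise_unit_affine f"
  shows "shuffle_of_min (graph_copula f)"
proof -
  let ?U = "restrict_space lborel {0..1::real}"
  let ?Q = "restrict_space (borel :: (real \<times> real) measure) ({0..1} \<times> {0..1})"
  define \<mu> where "\<mu> = distr ?U ?Q (\<lambda>t. (t, f t))"
  have meas [measurable]: "(\<lambda>t. (t, f t)) \<in> ?U \<rightarrow>\<^sub>M ?Q"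
  proof (rule measurable_restrict_space3)
    show "(\<lambda>t. (t, f t)) \<in> lborel \<rightarrow>\<^sub>M borel"
      unfolding borel_prod[symmetric] by measurable
    show "(\<lambda>t. (t, f t)) \<in> {0..1} \<rightarrow> {0..1} \<times> {0..1}" using in_unit by auto
  qed
  have "copula_measure (graph_copula f) \<mu>"
    unfolding copula_measure_def
  proof (intro conjI ballI impI)
    show "space \<mu> = {0..1} \<times> {0..1}" by (simp add: \<mu>_def space_restrict_space)
    show "sets \<mu> = sets ?Q" by (simp add: \<mu>_def)
    fix x u y v :: real
    assume xy: "x \<in> {0..1}" "u \<in> {0..1}" "y \<in> {0..1}" "v \<in> {0..1}" "x \<le> u" "y \<le> v"
    have R: "{x..u} \<times> {y..v} \<in> sets ?Q"
    proof -
      have "{x..u} \<times> {y..v} \<in> sets borel" "{0..1::real} \<times> {0..1::real} \<in> sets borel"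
        by (intro borel_closed closed_Times closed_atLeastAtMost)+
      then show ?thesis using xy by (subst sets_restrict_space_iff) auto
    qed
    have "emeasure \<mu> ({x..u} \<times> {y..v}) = emeasure ?U ((\<lambda>t. (t, f t)) -` ({x..u} \<times> {y..v}) \<inter> space ?U)"
      unfolding \<mu>_def by (rule emeasure_distr[OF meas R])
    also have "(\<lambda>t. (t, f t)) -` ({x..u} \<times> {y..v}) \<inter> space ?U = {t \<in> {x..u}. f t \<in> {y..v}}"
      using xy by (auto simp: space_restrict_space)
    also have "emeasure ?U {t \<in> {x..u}. f t \<in> {y..v}} = emeasure lborel {t \<in> {x..u}. f t \<in> {y..v}}"
      using xy by (intro emeasure_restrict_space) auto
    also have "\<dots> = ennreal (measure lborel {t \<in> {x..u}. f t \<in> {y..v}})"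
      by (intro emeasure_eq_measure2 fmeasurable_bounded) measurable
    finally show "emeasure \<mu> ({x..u} \<times> {y..v}) =
        ennreal (graph_copula f u v - graph_copula f u y - graph_copula f x v + graph_copula f x y)"
      using xy by (simp add: rectangle_volume)
  qed
  moreover have "AE p in \<mu>. p \<in> {(x, f x) | x. x \<in> {0..1}}"
  proof -
    have "Measurable.pred borel (\<lambda>p::real \<times> real. snd p = f (fst p))"
      unfolding borel_prod[symmetric] by measurable
    then have "{p::real \<times> real. snd p = f (fst p)} \<in> sets borel" by simp
    moreover have "{0..1::real} \<times> {0..1::real} \<in> sets borel"
      by (intro borel_closed closed_Times) auto
    ultimately have "{p. snd p = f (fst p)} \<inter> ({0..1} \<times> {0..1}) \<in> sets ?Q"
      by (subst sets_restrict_space_iff) auto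
    also have "{p. snd p = f (fst p)} \<inter> ({0..1} \<times> {0..1}) = {p \<in> space ?Q. p \<in> {(x, f x) | x. x \<in> {0..1}}}"
    proof (rule set_eqI)
      fix p :: "real \<times> real"
      show "p \<in> {p. snd p = f (fst p)} \<inter> ({0..1} \<times> {0..1}) \<longleftrightarrow> p \<in> {p \<in> space ?Q. p \<in> {(x, f x) | x. x \<in> {0..1}}}"
        using in_unit[of "fst p"] by (cases p) (auto simp: space_restrict_space)
    qed
    finally have "{p \<in> space ?Q. p \<in> {(x, f x) | x. x \<in> {0..1}}} \<in> sets ?Q" .
    then show ?thesis unfolding \<mu>_def
      by (subst AE_distr_iff[OF meas]) (auto simp: AE_restrict_space_iff)
  qed
  ultimately show ?thesis
    unfolding shuffle_of_min_def
    using copula bij aff lebesgue_preservingI[OF borel in_unit preserving] by blast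
qed

end

section \<open>Approximating a copula by shuffles\<close>

lemma unit_rearrangement_cell_exchange:
  assumes "copula C" "N > 0"
  shows "unit_rearrangement (cell_exchange C N)"
  using assms by unfold_locales
    (simp_all add: bij_betw_cell_exchange emeasure_cell_exchange_vimage_Icc)

definition grid_shuffle :: "(real \<Rightarrow> real \<Rightarrow> real) \<Rightarrow> nat \<Rightarrow> real \<Rightarrow> real \<Rightarrow> real" where
  "grid_shuffle C N = graph_copula (cell_exchange C N)"

lemma shuffle_of_min_grid_shuffle:
  assumes "copula C" "N > 0"
  shows "shuffle_of_min (grid_shuffle C N)"
  unfolding grid_shuffle_def using assms
  by (intro unit_rearrangement.shuffle_of_min unit_rearrangement_cell_exchange piecewise_unit_affine_cell_exchange)

text \<open>
In the \<open>i\<close>-th strip, the intervals that are sent below the level \<open>b / N\<close> are those of the cells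
\<open>(i, j)\<close> with \<open>j < b\<close>, and these form an initial segment of the strip.
\<close>
lemma strip_below_level:
  assumes C: "copula C" and ib: "i < N" "b \<le> N" and t: "t \<in> {real i / N..<real (Suc i) / N}"
  shows "cell_exchange C N t < real b / N \<longleftrightarrow> t < cut C N i b"
proof -
  have N: "N > 0" using ib by simp
  obtain j where j: "j < N" "t \<in> cell C N i j"
    using chain_locate[of "cut C N i" t N] cut_ends[OF C ib(1)] t by (auto simp: cell_def)
  have s: "cell_exchange C N t \<in> {real j / N..<real (Suc j) / N}"
    using cell_exchange_in_cell[OF C ib(1) j] cell_subset_strip[OF copula_transpose[OF C] j(1) ib(1)] by blast
  show ?thesis
  proof (cases "j < b")
    case True
    then have "real (Suc j) / N \<le> real b / N" by (intro divide_right_mono) auto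
    moreover have "cut C N i (Suc j) \<le> cut C N i b" using cut_mono[OF C ib(1)] True ib(2) by simp
    ultimately show ?thesis using s j(2) unfolding cell_def atLeastLessThan_iff by linarith
  next
    case False
    then have "real b / N \<le> real j / N" by (intro divide_right_mono) auto
    moreover have "cut C N i b \<le> cut C N i j" using cut_mono[OF C ib(1)] False j(1) by simp
    ultimately show ?thesis using s j(2) unfolding cell_def atLeastLessThan_iff by linarith
  qed
qed

text \<open>
Induction over the strips: the part of strip \<open>a\<close> that is sent below \<open>b / N\<close> is an interval whose length
is the increment of \<open>C\<close> across the strip at that level.
\<close>
lemma grid_shuffle_at_grid:
  assumes C: "copula C" and N: "N > 0" and "a \<le> N" and b: "b \<le> N"
  shows "grid_shuffle C N (real a / N) (real b / N) = C (real a / N) (real b / N)"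
  using assms(3)
proof (induction a)
  case 0
  have "copula (grid_shuffle C N)"
    using shuffle_of_min_grid_shuffle[OF C N] by (simp add: shuffle_of_min_def)
  then show ?case
    using copula_boundary(3)[OF C, of "real b / N"] copula_boundary(3)[of "grid_shuffle C N" "real b / N"] N b
    by (simp add: divide_simps)
next
  case (Suc a)
  interpret unit_rearrangement "cell_exchange C N" by (rule unit_rearrangement_cell_exchange[OF C N])
  let ?f = "cell_exchange C N" and ?v = "real b / N"
  let ?x = "real a / N" and ?u = "real (Suc a) / N"
  have a: "a < N" using Suc by simp
  have ends: "0 \<le> ?x" "?x \<le> ?u" "?u \<le> 1" "0 \<le> ?v" "?v \<le> 1" using a b by (auto simp: divide_simps)
  have cut: "?x \<le> cut C N a b" "cut C N a b \<le> ?u"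
    using cut_mono[OF C a, of 0 b] cut_mono[OF C a, of b N] cut_ends[OF C a] b by auto
  have "grid_shuffle C N ?u ?v - grid_shuffle C N ?x ?v = measure lborel {t \<in> {?x..?u}. ?f t \<in> {0..?v}}"
    using rectangle_volume[OF ends(1-4)] copula_boundary(1)[OF copula, of ?u] copula_boundary(1)[OF copula, of ?x] ends
    by (simp add: grid_shuffle_def)
  also have "\<dots> = measure lborel {?x..<cut C N a b}"
  proof (rule measure_eq_AE)
    show "AE t in lborel. t \<in> {t \<in> {?x..?u}. ?f t \<in> {0..?v}} \<longleftrightarrow> t \<in> {?x..<cut C N a b}"
      using AE_value_neq[of ?v] AE_lborel_singleton[of ?u]
    proof eventually_elim
      case (elim t)
      have "0 \<le> ?f t" "?f t \<noteq> ?v" if "t \<in> {?x..?u}"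
      proof -
        have "t \<in> {0..1}" using that ends unfolding atLeastAtMost_iff by linarith
        then show "0 \<le> ?f t" "?f t \<noteq> ?v" using in_unit[of t] elim(1) by auto
      qed
      note f = this
      show ?case
      proof (cases "t \<in> {?x..<?u}")
        case True
        then have t: "t \<in> {?x..?u}" "?x \<le> t" by simp_all
        have "?f t \<le> ?v \<longleftrightarrow> ?f t < ?v" unfolding order_le_less using f(2)[OF t(1)] by blast
        also have "\<dots> \<longleftrightarrow> t < cut C N a b" by (rule strip_below_level[OF C a b True])
        finally show ?thesis
          using t f(1)[OF t(1)] unfolding mem_Collect_eq atLeastAtMost_iff atLeastLessThan_iff by blast
      next
        case False
        then have "t \<notin> {?x..?u}" "t \<notin> {?x..<cut C N a b}"
          using elim(2) cut unfolding atLeastAtMost_iff atLeastLessThan_iff by linarith+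
        then show ?thesis by blast
      qed
    qed
  qed measurable
  also have "\<dots> = C ?u ?v - C ?x ?v" using cut by (simp add: cut_def)
  finally show ?case using Suc by simp
qed

text \<open>
From the grid point to the lower left of \<open>(x, y)\<close>, both copulas increase by an amount between 0
and \<open>2 / N\<close>.
\<close>
lemma copula_eq_on_grid_close:
  assumes C: "copula C" and D: "copula D" and N: "N > 0"
    and grid: "\<And>a b. a \<le> N \<Longrightarrow> b \<le> N \<Longrightarrow> C (real a / N) (real b / N) = D (real a / N) (real b / N)"
    and xy: "x \<in> {0..1}" "y \<in> {0..1}"
  shows "\<bar>C x y - D x y\<bar> \<le> 2 / real N"
proof -
  have low: "\<exists>a\<le>N. real a / N \<le> x \<and> x \<le> real a / N + 1 / N" if x: "x \<in> {0..1}" for x :: real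
  proof (intro exI conjI)
    have Nx: "0 \<le> x * N" "x * N \<le> N" using x N by (auto simp: mult_left_le_one_le)
    show "nat \<lfloor>x * N\<rfloor> \<le> N" using Nx by linarith
    have "real (nat \<lfloor>x * N\<rfloor>) \<le> x * N" "x * N \<le> real (nat \<lfloor>x * N\<rfloor>) + 1" using Nx by linarith+
    then show "real (nat \<lfloor>x * N\<rfloor>) / N \<le> x" "x \<le> real (nat \<lfloor>x * N\<rfloor>) / N + 1 / N"
      using N by (simp_all add: field_simps)
  qed
  obtain a where a: "a \<le> N" "real a / N \<le> x" "x \<le> real a / N + 1 / N" using low[OF xy(1)] by blast
  obtain b where b: "b \<le> N" "real b / N \<le> y" "y \<le> real b / N + 1 / N" using low[OF xy(2)] by blast
  have pos: "0 \<le> real a / N" "0 \<le> real b / N" "real b / N \<le> 1" "x \<le> 1" "y \<le> 1" "0 \<le> x"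
    using a b xy N by (auto simp: divide_simps)
  have step: "0 \<le> E x y - E (real a / N) (real b / N) \<and> E x y - E (real a / N) (real b / N) \<le> 2 / N"
    if E: "copula E" for E
    using copula_increment[OF E pos(1) a(2) pos(4) pos(2,3)]
      copula_increment[OF copula_transpose[OF E] pos(2) b(2) pos(5) pos(6,4)] a(3) b(3) by simp
  show ?thesis using step[OF C] step[OF D] grid[OF a(1) b(1)] by linarith
qed

lemma grid_shuffle_close:
  assumes C: "copula C" and N: "N > 0" and xy: "x \<in> {0..1}" "y \<in> {0..1}"
  shows "\<bar>grid_shuffle C N x y - C x y\<bar> \<le> 2 / real N"
proof (rule copula_eq_on_grid_close[OF _ C N _ xy])
  show "copula (grid_shuffle C N)"
    using shuffle_of_min_grid_shuffle[OF C N] by (simp add: shuffle_of_min_def)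
qed (rule grid_shuffle_at_grid[OF C N])

section \<open>Shuffles of Min approximate every copula of norm 1\<close>

theorem theorem3p4:
  fixes C :: "real \<Rightarrow> real \<Rightarrow> real"
  assumes "copula C" and "sobolev_norm C = 1"
  shows "\<exists>S :: nat \<Rightarrow> real \<Rightarrow> real \<Rightarrow> real.
           (\<forall>n. shuffle_of_min (S n)) \<and>
           (\<lambda>n. sobolev_norm (\<lambda>x y. C x y - S n x y)) \<longlonglongrightarrow> 0"
proof (intro exI[of _ "\<lambda>n. grid_shuffle C (Suc n)"] conjI allI)
  show shuffle: "shuffle_of_min (grid_shuffle C (Suc n))" for n
    by (rule shuffle_of_min_grid_shuffle[OF assms(1)]) simp
  show "(\<lambda>n. sobolev_norm (\<lambda>x y. C x y - grid_shuffle C (Suc n) x y)) \<longlonglongrightarrow> 0"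
  proof (rule sobolev_limit_of_pointwise_limit[OF assms])
    show "copula (grid_shuffle C (Suc n))" for n
      using shuffle[of n] by (simp add: shuffle_of_min_def)
    fix x y :: real assume xy: "x \<in> {0..1}" "y \<in> {0..1}"
    have "(\<lambda>n. 2 / real (Suc n)) \<longlonglongrightarrow> 0"
      by (rule LIMSEQ_Suc[OF lim_const_over_n])
    then have "(\<lambda>n. grid_shuffle C (Suc n) x y - C x y) \<longlonglongrightarrow> 0"
    proof (rule Lim_null_comparison[rotated])
      show "\<forall>\<^sub>F n in sequentially. norm (grid_shuffle C (Suc n) x y - C x y) \<le> 2 / real (Suc n)"
        unfolding real_norm_def
        by (intro always_eventually allI grid_shuffle_close[OF assms(1) zero_less_Suc xy])
    qed
    then show "(\<lambda>n. grid_shuffle C (Suc n) x y) \<longlonglongrightarrow> C x y"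
      by (rule LIM_zero_cancel)
  qed
qed

end
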